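(* The geometric RSK map $\mathbf{x}\mapsto(P,Q)$ is a birational isomorphism from $\mathrm{Mat}_{m\times n}(\mathbb{C}^* )$ to $X^{\mathrm{GT}}=\{(P,Q)\in\mathrm{GT}_n^{\le m}\times\mathrm{GT}_m^{\le n}:\mathrm{sh}(P)=\mathrm{sh}(Q)\}$ which is an isomorphism of $\mathrm{GL}_n\times\mathrm{GL}_m$-geometric crystals; that is, whenever $\mathrm{gRSK}(\mathbf{x})=(P,Q)$, we have for all $j\in[n-1]$, $i\in[m-1]$, $c\in\mathbb{C}^*$ (as identities of rational functions): $\bar\gamma(\mathbf{x})=\bar\gamma(P)$, $\bar\varepsilon_j(\mathbf{x})=\bar\varepsilon_j(P)$, $\bar\varphi_j(\mathbf{x})=\bar\varphi_j(P)$, $\mathrm{gRSK}(\bar e_j^c(\mathbf{x}))=(\bar e_j^c(P),Q)$, and $\gamma(\mathbf{x})=\gamma(Q)$, $\varepsilon_i(\mathbf{x})=\varepsilon_i(Q)$, $\varphi_i(\mathbf{x})=\varphi_i(Q)$, $\mathrm{gRSK}(e_i^c(\mathbf{x}))=(P,e_i^c(Q))$.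
   Context: Notation. For an $N\times N$ matrix $A$ and $I\subseteq[N]$, $\Delta_I(A)$ is the minor with rows $I$ and columns $[1,|I|]$, $\Delta_\emptyset=1$. $E_{a,b}$ is a matrix unit; $x_j(a)=I+aE_{j,j+1}$. $W(y_1,\dots,y_N)$ is the $N\times N$ matrix with diagonal $y_1,\dots,y_N$, $1$'s directly below the diagonal, $0$ elsewhere. Basic crystal structures on $\mathbf{x}=(x_i^j)\in\mathrm{Mat}_{m\times n}(\mathbb{C}^* )$, with rows $\mathbf{x}_i$ and columns $\mathbf{x}^j=(x_1^j,\dots,x_m^j)$: for vectors $u,v$ of length $L$, $\sigma^k(u,v;c)=\sum_{r=1}^L c^{\mathbb{1}_{r\le k}}v^1\cdots v^{r-1}u^{r+1}\cdots u^L$ and $\sigma(u,v)=\sigma^k(u,v;1)$. The $\mathrm{GL}_m$-structure: $\pi_k=\prod_j x_k^j$, $\gamma(\mathbf{x})=(\pi_1,\dots,\pi_m)$, $\varepsilon_i=\pi_{i+1}/\sigma(\mathbf{x}_i,\mathbf{x}_{i+1})$, $\varphi_i=\pi_i/\sigma(\mathbf{x}_i,\mathbf{x}_{i+1})$, and $e_i^c$ replaces $x_i^j$ by $x_i^j\sigma^j/\sigma^{j-1}$ and $x_{i+1}^j$ by $x_{i+1}^j\sigma^{j-1}/\sigma^j$ (with $\sigma^k=\sigma^k(\mathbf{x}_i,\mathbf{x}_{i+1};c)$), other entries fixed. The $\mathrm{GL}_n$-structure $\bar\gamma,\bar\varepsilon_j,\bar\varphi_j,\bar e_j^c$ is the same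 construction applied to columns: $\bar\pi_j=\prod_i x_i^j$, $\bar\gamma=(\bar\pi_1,\dots,\bar\pi_n)$, $\bar\varepsilon_j=\bar\pi_{j+1}/\sigma(\mathbf{x}^j,\mathbf{x}^{j+1})$, $\bar\varphi_j=\bar\pi_j/\sigma(\mathbf{x}^j,\mathbf{x}^{j+1})$, and $\bar e_j^c$ replaces $x_a^j$ by $x_a^j\sigma^a/\sigma^{a-1}$, $x_a^{j+1}$ by $x_a^{j+1}\sigma^{a-1}/\sigma^a$ with $\sigma^k=\sigma^k(\mathbf{x}^j,\mathbf{x}^{j+1};c)$. Gelfand–Tsetlin crystals. For $N,K\ge1$, $\mathrm{GT}_N^{\le K}$ is the torus of arrays $\mathbf{z}=(z_{i,j})$, $z_{i,j}\in\mathbb{C}^*$, $1\le i\le K$, $i\le j\le N$; its shape is $\mathrm{sh}(\mathbf{z})=(z_{1,N},\dots,z_{p,N})$, $p=\min(K,N)$. Let $W^i(y_i,\dots,y_N)=\sum_{k<i}E_{kk}+\sum_{k\ge i}y_kE_{kk}+\sum_{k=i}^{N-1}E_{k+1,k}$ ($N\times N$), $\Phi(\mathbf{z})=W^p(z_{p,p},\frac{z_{p,p+1}}{z_{p,p}},\dots,\frac{z_{p,N}}{z_{p,N-1}})\cdots W^1(z_{1,1},\frac{z_{1,2}}{z_{1,1}},\dots,\frac{z_{1,N}}{z_{1,N-1}})$, and for a lower triangular $A$, $\Psi(A)=(\Delta_{[i,j]}(A)/\Delta_{[i+1,j]}(A))_{i,j}$. With $A=\Phi(\mathbf{z})$, the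 $\mathrm{GL}_N$-geometric crystal structure on $\mathrm{GT}_N^{\le K}$ is $\gamma(\mathbf{z})=(A_{1,1},\dots,A_{N,N})$, $\varepsilon_j(\mathbf{z})=A_{j+1,j+1}/A_{j+1,j}$, $\varphi_j(\mathbf{z})=A_{j,j}/A_{j+1,j}$, $e_j^c(\mathbf{z})=\Psi\big(x_j((c-1)\varphi_j(\mathbf{z}))\,A\,x_j((c^{-1}-1)\varepsilon_j(\mathbf{z}))\big)$. On $\mathrm{GT}_n^{\le m}$ (as $\mathrm{GL}_n$-crystal) these are written $\bar\gamma,\bar\varepsilon_j,\bar\varphi_j,\bar e_j^c$; on $\mathrm{GT}_m^{\le n}$ (as $\mathrm{GL}_m$-crystal) $\gamma,\varepsilon_i,\varphi_i,e_i^c$. Geometric RSK. $M(\mathbf{x}_1,\dots,\mathbf{x}_k)=W(\mathbf{x}_1)\cdots W(\mathbf{x}_k)$ ($n\times n$). $\mathrm{gRSK}(\mathbf{x})=(P,Q)$ with $P=(z_{i,j})\in\mathrm{GT}_n^{\le m}$, $z_{i,j}=\Delta_{[i,j]}(M(\mathbf{x}_1,\dots,\mathbf{x}_m))/\Delta_{[i+1,j]}(M(\mathbf{x}_1,\dots,\mathbf{x}_m))$, and $Q=(z'_{j',i'})\in\mathrm{GT}_m^{\le n}$, $z'_{j',i'}=\Delta_{[j',n]}(M(\mathbf{x}_1,\dots,\mathbf{x}_{i'}))/\Delta_{[j'+1,n]}(M(\mathbf{x}_1,\dots,\mathbf{x}_{i'}))$ for $1\le j'\le n$, $j'\le i'\le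 m$. On $X^{\mathrm{GT}}$, $\bar e_j^c(P,Q)=(\bar e_j^c(P),Q)$, $e_i^c(P,Q)=(P,e_i^c(Q))$, and the other structure maps are those of $P$ (for $\mathrm{GL}_n$) and $Q$ (for $\mathrm{GL}_m$). *)

theory Defs
  imports Complex_Main "Jordan_Normal_Form.Determinant"
begin

(* Conventions: an m x n matrix x of Mat_{m x n}(C^x) is a function x :: nat => nat => complex,
   x i j = x_i^j for 1 <= i <= m, 1 <= j <= n (1-indexed; other entries are irrelevant).
   A GT array z in GT_N^{<=K} is z :: nat => nat => complex with z i j = z_{i,j} for
   1 <= i <= K, i <= j <= N.  Square N x N matrices are Jordan_Normal_Form matrices
   (0-indexed internally). *)

inductive poly_in :: "('a \<Rightarrow> complex) set \<Rightarrow> ('a \<Rightarrow> complex) \<Rightarrow> bool" for C where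
  poly_coord: "f \<in> C \<Longrightarrow> poly_in C f"
| poly_const: "poly_in C (\<lambda>_. a)"
| poly_add: "poly_in C f \<Longrightarrow> poly_in C g \<Longrightarrow> poly_in C (\<lambda>y. f y + g y)"
| poly_mult: "poly_in C f \<Longrightarrow> poly_in C g \<Longrightarrow> poly_in C (\<lambda>y. f y * g y)"

inductive rat_in :: "('a \<Rightarrow> complex) set \<Rightarrow> ('a \<Rightarrow> complex) \<Rightarrow> bool" for C where
  rat_coord: "f \<in> C \<Longrightarrow> rat_in C f"
| rat_const: "rat_in C (\<lambda>_. a)"
| rat_add: "rat_in C f \<Longrightarrow> rat_in C g \<Longrightarrow> rat_in C (\<lambda>y. f y + g y)"
| rat_mult: "rat_in C f \<Longrightarrow> rat_in C g \<Longrightarrow> rat_in C (\<lambda>y. f y * g y)"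
| rat_inverse: "rat_in C f \<Longrightarrow> rat_in C (\<lambda>y. inverse (f y))"

text \<open>A property holds generically on the (irreducible) set S, i.e. on a nonempty Zariski open
  subset of S: outside the zero set of a polynomial (in the coordinates C) that does not
  vanish identically on S.\<close>
definition generic_on :: "('a \<Rightarrow> complex) set \<Rightarrow> 'a set \<Rightarrow> ('a \<Rightarrow> bool) \<Rightarrow> bool" where
  "generic_on C S P \<longleftrightarrow>
     (\<exists>f. poly_in C f \<and> (\<exists>y\<in>S. f y \<noteq> 0) \<and> (\<forall>y\<in>S. f y \<noteq> 0 \<longrightarrow> P y))"

definition mat_coords :: "((nat \<Rightarrow> nat \<Rightarrow> complex) \<Rightarrow> complex) set" where
  "mat_coords = {(\<lambda>x. x i j) | i j. True}"

definition pair_coords :: "((nat \<Rightarrow> nat \<Rightarrow> complex) \<times> (nat \<Rightarrow> nat \<Rightarrow> complex) \<Rightarrow> complex) set" where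
  "pair_coords = {(\<lambda>y. fst y i j) | i j. True} \<union> {(\<lambda>y. snd y i j) | i j. True}"

definition Mat_torus :: "nat \<Rightarrow> nat \<Rightarrow> (nat \<Rightarrow> nat \<Rightarrow> complex) set" where
  "Mat_torus m n = {x. \<forall>i j. 1 \<le> i \<and> i \<le> m \<and> 1 \<le> j \<and> j \<le> n \<longrightarrow> x i j \<noteq> 0}"

definition mat_eq :: "nat \<Rightarrow> nat \<Rightarrow> (nat \<Rightarrow> nat \<Rightarrow> complex) \<Rightarrow> (nat \<Rightarrow> nat \<Rightarrow> complex) \<Rightarrow> bool" where
  "mat_eq m n x y \<longleftrightarrow> (\<forall>i j. 1 \<le> i \<and> i \<le> m \<and> 1 \<le> j \<and> j \<le> n \<longrightarrow> x i j = y i j)"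

definition GT_torus :: "nat \<Rightarrow> nat \<Rightarrow> (nat \<Rightarrow> nat \<Rightarrow> complex) set" where
  "GT_torus N K = {z. \<forall>i j. 1 \<le> i \<and> i \<le> K \<and> i \<le> j \<and> j \<le> N \<longrightarrow> z i j \<noteq> 0}"

definition gt_eq :: "nat \<Rightarrow> nat \<Rightarrow> (nat \<Rightarrow> nat \<Rightarrow> complex) \<Rightarrow> (nat \<Rightarrow> nat \<Rightarrow> complex) \<Rightarrow> bool" where
  "gt_eq N K z w \<longleftrightarrow> (\<forall>i j. 1 \<le> i \<and> i \<le> K \<and> i \<le> j \<and> j \<le> N \<longrightarrow> z i j = w i j)"

definition XGT :: "nat \<Rightarrow> nat \<Rightarrow> ((nat \<Rightarrow> nat \<Rightarrow> complex) \<times> (nat \<Rightarrow> nat \<Rightarrow> complex)) set" where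
  "XGT m n = {(P, Q). P \<in> GT_torus n m \<and> Q \<in> GT_torus m n \<and>
                (\<forall>k. 1 \<le> k \<and> k \<le> min m n \<longrightarrow> P k n = Q k m)}"

text \<open>Delta_{[a,b]}(A): rows a..b (1-indexed), columns 1..(b-a+1); the empty minor is 1.\<close>
definition delta_int :: "complex mat \<Rightarrow> nat \<Rightarrow> nat \<Rightarrow> complex" where
  "delta_int A a b = (let k = Suc b - a in det (mat k k (\<lambda>(r, c). A $$ (a - 1 + r, c))))"

definition Psi :: "complex mat \<Rightarrow> nat \<Rightarrow> nat \<Rightarrow> complex" where
  "Psi A i j = delta_int A i j / delta_int A (i + 1) j"

definition Wmat :: "nat \<Rightarrow> (nat \<Rightarrow> complex) \<Rightarrow> complex mat" where
  "Wmat N y = mat N N (\<lambda>(r, c). if r = c then y (r + 1) else if r = c + 1 then 1 else 0)"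

fun Mprod :: "nat \<Rightarrow> (nat \<Rightarrow> nat \<Rightarrow> complex) \<Rightarrow> nat \<Rightarrow> complex mat" where
  "Mprod n x 0 = 1\<^sub>m n"
| "Mprod n x (Suc k) = Mprod n x k * Wmat n (x (Suc k))"

definition gRSK_P :: "nat \<Rightarrow> nat \<Rightarrow> (nat \<Rightarrow> nat \<Rightarrow> complex) \<Rightarrow> nat \<Rightarrow> nat \<Rightarrow> complex" where
  "gRSK_P m n x = Psi (Mprod n x m)"

definition gRSK_Q :: "nat \<Rightarrow> nat \<Rightarrow> (nat \<Rightarrow> nat \<Rightarrow> complex) \<Rightarrow> nat \<Rightarrow> nat \<Rightarrow> complex" where
  "gRSK_Q m n x = (\<lambda>j' i'. delta_int (Mprod n x i') j' n / delta_int (Mprod n x i') (j' + 1) n)"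

definition gRSK :: "nat \<Rightarrow> nat \<Rightarrow> (nat \<Rightarrow> nat \<Rightarrow> complex)
    \<Rightarrow> (nat \<Rightarrow> nat \<Rightarrow> complex) \<times> (nat \<Rightarrow> nat \<Rightarrow> complex)" where
  "gRSK m n x = (gRSK_P m n x, gRSK_Q m n x)"

definition WGT :: "nat \<Rightarrow> (nat \<Rightarrow> nat \<Rightarrow> complex) \<Rightarrow> nat \<Rightarrow> complex mat" where
  "WGT N z i = mat N N (\<lambda>(r, c).
     if r = c then (if r + 1 < i then 1 else if r + 1 = i then z i i else z i (r + 1) / z i r)
     else if r = c + 1 \<and> i \<le> c + 1 then 1 else 0)"

fun PhiProd :: "nat \<Rightarrow> (nat \<Rightarrow> nat \<Rightarrow> complex) \<Rightarrow> nat \<Rightarrow> complex mat" where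
  "PhiProd N z 0 = 1\<^sub>m N"
| "PhiProd N z (Suc k) = WGT N z (Suc k) * PhiProd N z k"

definition Phi :: "nat \<Rightarrow> nat \<Rightarrow> (nat \<Rightarrow> nat \<Rightarrow> complex) \<Rightarrow> complex mat" where
  "Phi N K z = PhiProd N z (min K N)"

definition xj :: "nat \<Rightarrow> nat \<Rightarrow> complex \<Rightarrow> complex mat" where
  "xj N j a = mat N N (\<lambda>(r, c). if r = c then 1 else if r + 1 = j \<and> c = j then a else 0)"

definition gt_gamma :: "nat \<Rightarrow> nat \<Rightarrow> (nat \<Rightarrow> nat \<Rightarrow> complex) \<Rightarrow> nat \<Rightarrow> complex" where
  "gt_gamma N K z k = Phi N K z $$ (k - 1, k - 1)"

definition gt_eps :: "nat \<Rightarrow> nat \<Rightarrow> (nat \<Rightarrow> nat \<Rightarrow> complex) \<Rightarrow> nat \<Rightarrow> complex" where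
  "gt_eps N K z j = Phi N K z $$ (j, j) / Phi N K z $$ (j, j - 1)"

definition gt_phi :: "nat \<Rightarrow> nat \<Rightarrow> (nat \<Rightarrow> nat \<Rightarrow> complex) \<Rightarrow> nat \<Rightarrow> complex" where
  "gt_phi N K z j = Phi N K z $$ (j - 1, j - 1) / Phi N K z $$ (j, j - 1)"

definition gt_e :: "nat \<Rightarrow> nat \<Rightarrow> nat \<Rightarrow> complex \<Rightarrow> (nat \<Rightarrow> nat \<Rightarrow> complex) \<Rightarrow> nat \<Rightarrow> nat \<Rightarrow> complex" where
  "gt_e N K j c z = Psi (xj N j ((c - 1) * gt_phi N K z j) * Phi N K z
                        * xj N j ((inverse c - 1) * gt_eps N K z j))"

definition sigma :: "nat \<Rightarrow> (nat \<Rightarrow> complex) \<Rightarrow> (nat \<Rightarrow> complex) \<Rightarrow> complex \<Rightarrow> nat \<Rightarrow> complex" where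
  "sigma L u v c k = (\<Sum>r\<in>{1..L}. (if r \<le> k then c else 1)
        * (\<Prod>s\<in>{1..<r}. v s) * (\<Prod>s\<in>{r<..L}. u s))"

definition sigma1 :: "nat \<Rightarrow> (nat \<Rightarrow> complex) \<Rightarrow> (nat \<Rightarrow> complex) \<Rightarrow> complex" where
  "sigma1 L u v = sigma L u v 1 0"

definition row_pi :: "nat \<Rightarrow> (nat \<Rightarrow> nat \<Rightarrow> complex) \<Rightarrow> nat \<Rightarrow> complex" where
  "row_pi n x k = (\<Prod>j\<in>{1..n}. x k j)"

definition row_eps :: "nat \<Rightarrow> (nat \<Rightarrow> nat \<Rightarrow> complex) \<Rightarrow> nat \<Rightarrow> complex" where
  "row_eps n x i = row_pi n x (i + 1) / sigma1 n (x i) (x (i + 1))"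

definition row_phi :: "nat \<Rightarrow> (nat \<Rightarrow> nat \<Rightarrow> complex) \<Rightarrow> nat \<Rightarrow> complex" where
  "row_phi n x i = row_pi n x i / sigma1 n (x i) (x (i + 1))"

definition row_e :: "nat \<Rightarrow> nat \<Rightarrow> complex \<Rightarrow> (nat \<Rightarrow> nat \<Rightarrow> complex) \<Rightarrow> nat \<Rightarrow> nat \<Rightarrow> complex" where
  "row_e n i c x = (\<lambda>a b.
     if a = i then x a b * sigma n (x i) (x (i + 1)) c b / sigma n (x i) (x (i + 1)) c (b - 1)
     else if a = i + 1 then x a b * sigma n (x i) (x (i + 1)) c (b - 1) / sigma n (x i) (x (i + 1)) c b
     else x a b)"

definition col_pi :: "nat \<Rightarrow> (nat \<Rightarrow> nat \<Rightarrow> complex) \<Rightarrow> nat \<Rightarrow> complex" where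
  "col_pi m x k = (\<Prod>i\<in>{1..m}. x i k)"

definition col_eps :: "nat \<Rightarrow> (nat \<Rightarrow> nat \<Rightarrow> complex) \<Rightarrow> nat \<Rightarrow> complex" where
  "col_eps m x j = col_pi m x (j + 1) / sigma1 m (\<lambda>a. x a j) (\<lambda>a. x a (j + 1))"

definition col_phi :: "nat \<Rightarrow> (nat \<Rightarrow> nat \<Rightarrow> complex) \<Rightarrow> nat \<Rightarrow> complex" where
  "col_phi m x j = col_pi m x j / sigma1 m (\<lambda>a. x a j) (\<lambda>a. x a (j + 1))"

definition col_e :: "nat \<Rightarrow> nat \<Rightarrow> complex \<Rightarrow> (nat \<Rightarrow> nat \<Rightarrow> complex) \<Rightarrow> nat \<Rightarrow> nat \<Rightarrow> complex" where
  "col_e m j c x = (let s = sigma m (\<lambda>a. x a j) (\<lambda>a. x a (j + 1)) c in (\<lambda>a b.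
     if b = j then x a b * s a / s (a - 1)
     else if b = j + 1 then x a b * s (a - 1) / s a
     else x a b))"

end

theory Submission
  imports Defs
begin

text \<open>The matrix \<open>M = W(x\<^sub>1) \<cdots> W(x\<^sub>m)\<close> is recovered from \<open>P\<close> as \<open>\<Phi>(P)\<close>, because a banded matrix is
  determined by its flag minors. The column crystal operators multiply \<open>M\<close> on both sides by upper
  unipotent matrices, which slide through the product and leave all bottom left minors, hence \<open>Q\<close>,
  unchanged. A duality of Pluecker type between the bottom left minors for \<open>x\<close> and for its transpose
  shows that transposing \<open>x\<close> exchanges \<open>P\<close> and \<open>Q\<close>, so the statements for rows follow from those for
  columns. For the inverse, the shape recorded in column \<open>k\<close> of \<open>Q\<close> determines the first column of
  \<open>W(x\<^sub>1) \<cdots> W(x\<^sub>k)\<close> from \<open>W(x\<^sub>1) \<cdots> W(x\<^sub>k\<^sub>+\<^sub>1)\<close> through a triangular linear system, and this column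
  determines the factor \<open>W(x\<^sub>k\<^sub>+\<^sub>1)\<close>.\<close>

section \<open>Rational functions and genericity\<close>

text \<open>Division is total with \<open>inverse 0 = 0\<close>, so the recurring obstacle is to
  exhibit points at which no denominator vanishes. For matrices such points come from explicit
  sparse witnesses, one for each minor, combined along lines. For \<open>XGT\<close> the point
  \<open>gRSK m n x\<close> of a single nondegenerate \<open>x\<close> is a witness for all
  conditions at once: there the recursively defined inverse retraces the true partial products of
  \<open>x\<close>, whose relevant minors and diagonal entries are nonzero. The two compositions
  with the inverse are proved separately. Starting from a pair \<open>(P, Q)\<close>, nothing
  guarantees beforehand that the reconstructed matrices are products of bidiagonal factors. They are
  shown to stay banded, with the bottom left minors that \<open>Q\<close> prescribes, until the band
  has shrunk to the identity; the equality of shapes is exactly the start of this induction.\<close>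

locale function_algebra =
  fixes R :: "('a \<Rightarrow> complex) \<Rightarrow> bool"
  assumes const: "R (\<lambda>_. a)"
    and add: "R f \<Longrightarrow> R g \<Longrightarrow> R (\<lambda>y. f y + g y)"
    and mult: "R f \<Longrightarrow> R g \<Longrightarrow> R (\<lambda>y. f y * g y)"
begin

lemma diff: "R f \<Longrightarrow> R g \<Longrightarrow> R (\<lambda>y. f y - g y)"
  using add[of f "\<lambda>y. -1 * g y"] mult[OF const, of g "-1"] by simp

lemma sum: "(\<And>i. i \<in> I \<Longrightarrow> R (f i)) \<Longrightarrow> R (\<lambda>y. \<Sum>i\<in>I. f i y)"
  by (induction I rule: infinite_finite_induct) (auto intro: const add)

lemma prod: "(\<And>i. i \<in> I \<Longrightarrow> R (f i)) \<Longrightarrow> R (\<lambda>y. \<Prod>i\<in>I. f i y)"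
  by (induction I rule: infinite_finite_induct) (auto intro: const mult)

text \<open>The Leibniz formula uses ring operations only, so one proof serves both polynomials and
  fractions that are regular at a point.\<close>

lemma det:
  assumes "\<And>i j. i < k \<Longrightarrow> j < k \<Longrightarrow> R (\<lambda>y. A y i j)"
  shows "R (\<lambda>y. det (mat k k (\<lambda>(i, j). A y i j)))"
proof -
  have "R (\<lambda>y. \<Sum>p\<in>{p. p permutes {0..<k}}. signof p * (\<Prod>i = 0..<k. A y i (p i)))"
    by (intro sum mult prod const assms) (auto dest: permutes_in_image)
  moreover have "det (mat k k (\<lambda>(i, j). A y i j)) =
      (\<Sum>p\<in>{p. p permutes {0..<k}}. signof p * (\<Prod>i = 0..<k. A y i (p i)))" for y
    by (subst det_def'[where n = k]) (auto intro!: sum.cong prod.cong dest: permutes_in_image)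
  ultimately show ?thesis by simp
qed

end

interpretation poly_in: function_algebra "poly_in C" for C
  by unfold_locales (auto intro: poly_in.intros)

lemma rat_in_divide: "rat_in C f \<Longrightarrow> rat_in C g \<Longrightarrow> rat_in C (\<lambda>y. f y / g y)"
  unfolding divide_inverse by (intro rat_mult rat_inverse)

lemma poly_in_imp_rat_in: "poly_in C f \<Longrightarrow> rat_in C f"
  by (induction rule: poly_in.induct) (auto intro: rat_in.intros)

text \<open>Bundling membership in \<open>rat_in\<close> with a presentation as a fraction whose denominator does
  not vanish at \<open>y\<^sub>0\<close> keeps the junk value \<open>inverse 0 = 0\<close> out of all denominators.\<close>

definition regular_at :: "('a \<Rightarrow> complex) set \<Rightarrow> 'a \<Rightarrow> ('a \<Rightarrow> complex) \<Rightarrow> bool" where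
  "regular_at C y\<^sub>0 f \<longleftrightarrow> rat_in C f \<and>
     (\<exists>p q. poly_in C p \<and> poly_in C q \<and> q y\<^sub>0 \<noteq> 0 \<and> (\<forall>y. q y \<noteq> 0 \<longrightarrow> f y = p y / q y))"

lemma regular_at_imp_rat_in: "regular_at C y\<^sub>0 f \<Longrightarrow> rat_in C f"
  by (simp add: regular_at_def)

lemma regular_at_poly: "poly_in C f \<Longrightarrow> regular_at C y\<^sub>0 f"
  unfolding regular_at_def
  by (intro conjI poly_in_imp_rat_in exI[of _ f] exI[of _ "\<lambda>_. 1"]) (auto intro: poly_const)

lemma regular_at_inverse:
  assumes "regular_at C y\<^sub>0 f" "f y\<^sub>0 \<noteq> 0"
  shows "regular_at C y\<^sub>0 (\<lambda>y. inverse (f y))"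
proof -
  from assms(1) obtain p q where pq: "rat_in C f" "poly_in C p" "poly_in C q" "q y\<^sub>0 \<noteq> 0"
    "\<And>y. q y \<noteq> 0 \<Longrightarrow> f y = p y / q y"
    unfolding regular_at_def by blast
  have "p y\<^sub>0 * q y\<^sub>0 \<noteq> 0" using pq(4,5) assms(2) by auto
  \<comment> \<open>The naive fraction \<open>q / p\<close> would not do: where \<open>q\<close>
    vanishes, nothing is known about \<open>f\<close>. The extra factor \<open>q\<close> excludes
    those points.\<close>
  moreover have "inverse (f y) = (q y * q y) / (p y * q y)" if "p y * q y \<noteq> 0" for y
    using that pq(5)[of y] by simp
  ultimately show ?thesis unfolding regular_at_def
    using pq by (intro conjI rat_inverse exI[of _ "\<lambda>y. q y * q y"] exI[of _ "\<lambda>y. p y * q y"])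
      (auto intro: poly_mult)
qed

interpretation regular_at: function_algebra "regular_at C y\<^sub>0" for C y\<^sub>0
proof
  show "regular_at C y\<^sub>0 (\<lambda>_. a)" for a by (intro regular_at_poly poly_const)
next
  fix f g assume "regular_at C y\<^sub>0 f" "regular_at C y\<^sub>0 g"
  then obtain p q p' q' where f: "rat_in C f" "poly_in C p" "poly_in C q" "q y\<^sub>0 \<noteq> 0"
    "\<And>y. q y \<noteq> 0 \<Longrightarrow> f y = p y / q y" and g: "rat_in C g" "poly_in C p'" "poly_in C q'" "q' y\<^sub>0 \<noteq> 0"
    "\<And>y. q' y \<noteq> 0 \<Longrightarrow> g y = p' y / q' y"
    unfolding regular_at_def by metis
  show "regular_at C y\<^sub>0 (\<lambda>y. f y + g y)" unfolding regular_at_def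
    using f g by (intro conjI rat_add exI[of _ "\<lambda>y. p y * q' y + p' y * q y"] exI[of _ "\<lambda>y. q y * q' y"])
      (auto intro: poly_mult poly_add simp: field_simps)
  show "regular_at C y\<^sub>0 (\<lambda>y. f y * g y)" unfolding regular_at_def
    using f g by (intro conjI rat_mult exI[of _ "\<lambda>y. p y * p' y"] exI[of _ "\<lambda>y. q y * q' y"])
      (auto intro: poly_mult)
qed

lemma regular_at_divide:
  "regular_at C y\<^sub>0 f \<Longrightarrow> regular_at C y\<^sub>0 g \<Longrightarrow> g y\<^sub>0 \<noteq> 0 \<Longrightarrow> regular_at C y\<^sub>0 (\<lambda>y. f y / g y)"
  unfolding divide_inverse by (intro regular_at.mult regular_at_inverse)

text \<open>All conditions are witnessed at the same point, so the product of the polynomials is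
  nonzero there. This is how finitely many conditions are intersected on \<open>XGT\<close>.\<close>

lemma generic_on_regular_nonzero:
  assumes "finite I" "y\<^sub>0 \<in> S" "\<And>i. i \<in> I \<Longrightarrow> regular_at C y\<^sub>0 (f i)" "\<And>i. i \<in> I \<Longrightarrow> f i y\<^sub>0 \<noteq> 0"
  shows "generic_on C S (\<lambda>y. \<forall>i\<in>I. f i y \<noteq> 0)"
proof -
  have "\<forall>i\<in>I. \<exists>h. poly_in C h \<and> h y\<^sub>0 \<noteq> 0 \<and> (\<forall>y. h y \<noteq> 0 \<longrightarrow> f i y \<noteq> 0)"
  proof
    fix i assume i: "i \<in> I"
    from assms(3)[OF i] obtain p q where pq: "poly_in C p" "poly_in C q" "q y\<^sub>0 \<noteq> 0"
      "\<And>y. q y \<noteq> 0 \<Longrightarrow> f i y = p y / q y"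
      unfolding regular_at_def by blast
    with assms(4)[OF i] show "\<exists>h. poly_in C h \<and> h y\<^sub>0 \<noteq> 0 \<and> (\<forall>y. h y \<noteq> 0 \<longrightarrow> f i y \<noteq> 0)"
      by (intro exI[of _ "\<lambda>y. p y * q y"]) (auto intro: poly_mult)
  qed
  then obtain h where h: "\<And>i. i \<in> I \<Longrightarrow> poly_in C (h i) \<and> h i y\<^sub>0 \<noteq> 0 \<and> (\<forall>y. h i y \<noteq> 0 \<longrightarrow> f i y \<noteq> 0)"
    by metis
  show ?thesis unfolding generic_on_def using assms(1,2) h
    by (intro exI[of _ "\<lambda>y. \<Prod>i\<in>I. h i y"]) (auto intro!: poly_in.prod)
qed

lemma generic_on_mono:
  assumes "generic_on C S P" "\<And>y. y \<in> S \<Longrightarrow> P y \<Longrightarrow> Q y"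
  shows "generic_on C S Q"
  using assms unfolding generic_on_def by blast

lemma generic_onE:
  assumes "generic_on C S P"
  obtains y where "y \<in> S" "P y"
  using assms unfolding generic_on_def by blast

section \<open>Generic conditions on the torus of matrices\<close>

lemma poly_in_line:
  assumes "poly_in mat_coords f"
  shows "\<exists>p. \<forall>t. f (\<lambda>i j. a i j + t * (b i j - a i j)) = poly p t"
  using assms
proof (induction rule: poly_in.induct)
  case (poly_coord f)
  then obtain i j where "f = (\<lambda>x. x i j)" by (auto simp: mat_coords_def)
  then show ?case by (intro exI[of _ "[:a i j, b i j - a i j:]"]) auto
next
  case (poly_const c)
  then show ?case by (intro exI[of _ "[:c:]"]) auto
next
  case (poly_add f g)
  then obtain p q where "\<forall>t. f (\<lambda>i j. a i j + t * (b i j - a i j)) = poly p t"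
    "\<forall>t. g (\<lambda>i j. a i j + t * (b i j - a i j)) = poly q t" by blast
  then show ?case by (intro exI[of _ "p + q"]) auto
next
  case (poly_mult f g)
  then obtain p q where "\<forall>t. f (\<lambda>i j. a i j + t * (b i j - a i j)) = poly p t"
    "\<forall>t. g (\<lambda>i j. a i j + t * (b i j - a i j)) = poly q t" by blast
  then show ?case by (intro exI[of _ "p * q"]) auto
qed

text \<open>Restricting to the line through two points reduces this to univariate polynomials.\<close>

lemma poly_in_mult_nonzero:
  assumes "poly_in mat_coords f" "poly_in mat_coords g" "f a \<noteq> 0" "g b \<noteq> 0"
  shows "\<exists>x. f x * g x \<noteq> 0"
proof -
  from poly_in_line[OF assms(1)] obtain p where p: "\<And>t. f (\<lambda>i j. a i j + t * (b i j - a i j)) = poly p t" by blast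
  from poly_in_line[OF assms(2)] obtain q where q: "\<And>t. g (\<lambda>i j. a i j + t * (b i j - a i j)) = poly q t" by blast
  from p[of 0] q[of 1] assms(3,4) have "p \<noteq> 0" "q \<noteq> 0" by auto
  then have "finite {t. poly (p * q) t = 0}" by (intro poly_roots_finite) auto
  then obtain t where "poly (p * q) t \<noteq> 0"
    using infinite_UNIV_char_0[where 'a = complex] by (metis (mono_tags, lifting) UNIV_eq_I mem_Collect_eq)
  then show ?thesis by (intro exI[of _ "\<lambda>i j. a i j + t * (b i j - a i j)"]) (simp add: p q)
qed

lemma poly_in_prod_nonzero:
  assumes "finite I" "\<And>i. i \<in> I \<Longrightarrow> poly_in mat_coords (f i)" "\<And>i. i \<in> I \<Longrightarrow> \<exists>x. f i x \<noteq> 0"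
  shows "\<exists>x. (\<Prod>i\<in>I. f i x) \<noteq> 0"
  using assms
proof (induction I rule: finite_induct)
  case (insert i I)
  then have "\<exists>a. f i a \<noteq> 0" "\<exists>b. (\<Prod>i\<in>I. f i b) \<noteq> 0" by blast+
  then obtain a b where "f i a \<noteq> 0" "(\<Prod>i\<in>I. f i b) \<noteq> 0" by blast
  with insert poly_in_mult_nonzero[of "f i" "\<lambda>x. \<Prod>i\<in>I. f i x" a b] show ?case
    by (auto intro: poly_in.prod)
qed auto

text \<open>The witness \<open>a\<close> may have zero entries: multiplying \<open>f\<close> by the
  product of all coordinates, which is nonzero at the all-ones matrix, produces a nonvanishing point
  inside the torus. This permits sparse witnesses later.\<close>

lemma generic_on_MatI:
  assumes "poly_in mat_coords f" "f a \<noteq> 0" "\<And>x. x \<in> Mat_torus m n \<Longrightarrow> f x \<noteq> 0 \<Longrightarrow> P x"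
  shows "generic_on mat_coords (Mat_torus m n) P"
proof -
  have "\<exists>x. (\<Prod>i\<in>{1..m} \<times> {1..n}. x (fst i) (snd i) :: complex) \<noteq> 0"
    by (intro exI[of _ "\<lambda>_ _. 1"]) auto
  then obtain b :: "nat \<Rightarrow> nat \<Rightarrow> complex" where b: "(\<Prod>i\<in>{1..m} \<times> {1..n}. b (fst i) (snd i)) \<noteq> 0" by blast
  have coords: "poly_in mat_coords (\<lambda>x. \<Prod>i\<in>{1..m} \<times> {1..n}. x (fst i) (snd i))"
    by (intro poly_in.prod poly_coord) (auto simp: mat_coords_def)
  from poly_in_mult_nonzero[OF assms(1) coords assms(2) b] obtain x where
    x: "f x * (\<Prod>i\<in>{1..m} \<times> {1..n}. x (fst i) (snd i)) \<noteq> 0" by blast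
  then have "x \<in> Mat_torus m n" by (auto simp: Mat_torus_def)
  with x assms show ?thesis unfolding generic_on_def by (intro exI[of _ f]) auto
qed

lemma generic_on_Mat_nonzero:
  assumes "finite I" "\<And>i. i \<in> I \<Longrightarrow> poly_in mat_coords (f i)" "\<And>i. i \<in> I \<Longrightarrow> \<exists>x. f i x \<noteq> 0"
  shows "generic_on mat_coords (Mat_torus m n) (\<lambda>x. \<forall>i\<in>I. f i x \<noteq> 0)"
proof -
  obtain a where "(\<Prod>i\<in>I. f i a) \<noteq> 0" using poly_in_prod_nonzero[of I f] assms by blast
  with assms show ?thesis
    by (intro generic_on_MatI[of "\<lambda>x. \<Prod>i\<in>I. f i x"]) (auto intro: poly_in.prod)
qed

lemma generic_on_Mat_conj:
  assumes "generic_on mat_coords (Mat_torus m n) P" "generic_on mat_coords (Mat_torus m n) Q"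
  shows "generic_on mat_coords (Mat_torus m n) (\<lambda>x. P x \<and> Q x)"
proof -
  from assms obtain f g a b where fg: "poly_in mat_coords f" "poly_in mat_coords g" "f a \<noteq> 0" "g b \<noteq> 0"
    "\<And>x. x \<in> Mat_torus m n \<Longrightarrow> f x \<noteq> 0 \<Longrightarrow> P x" "\<And>x. x \<in> Mat_torus m n \<Longrightarrow> g x \<noteq> 0 \<Longrightarrow> Q x"
    unfolding generic_on_def by metis
  from poly_in_mult_nonzero[OF fg(1-4)] obtain c where "f c * g c \<noteq> 0" by blast
  then show ?thesis using fg
    by (intro generic_on_MatI[of "\<lambda>x. f x * g x"]) (auto intro: poly_mult)
qed

section \<open>Transposition of arrays\<close>

definition transp :: "(nat \<Rightarrow> nat \<Rightarrow> complex) \<Rightarrow> nat \<Rightarrow> nat \<Rightarrow> complex" where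
  "transp x i j = x j i"

lemma transp_transp [simp]: "transp (transp x) = x"
  by (simp add: transp_def fun_eq_iff)

lemma transp_in_Mat_torus: "transp x \<in> Mat_torus m n \<longleftrightarrow> x \<in> Mat_torus n m"
  by (auto simp: Mat_torus_def transp_def)

lemma generic_on_transp:
  assumes "generic_on mat_coords (Mat_torus n m) P"
  shows "generic_on mat_coords (Mat_torus m n) (\<lambda>x. P (transp x))"
proof -
  from assms obtain f a where f: "poly_in mat_coords f" "a \<in> Mat_torus n m" "f a \<noteq> 0"
    "\<And>x. x \<in> Mat_torus n m \<Longrightarrow> f x \<noteq> 0 \<Longrightarrow> P x"
    unfolding generic_on_def by blast
  from f(1) have "poly_in mat_coords (\<lambda>x. f (transp x))"
    by (induction rule: poly_in.induct)
      (auto intro: poly_const poly_add poly_mult poly_coord simp: mat_coords_def transp_def)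
  then show ?thesis using f
    by (intro generic_on_MatI[of "\<lambda>x. f (transp x)" "transp a"]) (auto simp: transp_in_Mat_torus)
qed

section \<open>Products of bidiagonal matrices and their flag minors\<close>

text \<open>Entries of \<open>W(x\<^sub>1) \<cdots> W(x\<^sub>k)\<close> for \<open>W\<close> of infinite size; rows and columns are numbered from 0.
  The truncation to any finite size is harmless because the matrices are lower triangular.\<close>

fun wprod :: "(nat \<Rightarrow> nat \<Rightarrow> complex) \<Rightarrow> nat \<Rightarrow> nat \<Rightarrow> nat \<Rightarrow> complex" where
  "wprod x 0 r c = of_bool (r = c)"
| "wprod x (Suc k) r c = wprod x k r c * x (Suc k) (Suc c) + wprod x k r (Suc c)"

text \<open>The minor of rows \<open>[i,j]\<close> in 1-based numbering is \<open>t = i - 1\<close>,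
  \<open>s = j - i + 1\<close>; the empty minor is \<open>s = 0\<close>.\<close>

definition flag_minor :: "(nat \<Rightarrow> nat \<Rightarrow> complex) \<Rightarrow> nat \<Rightarrow> nat \<Rightarrow> complex" where
  "flag_minor A t s = det (mat s s (\<lambda>(r, c). A (t + r) c))"

text \<open>The common shape of \<open>wprod x k\<close>, \<open>gt_prod z k\<close> and all
  matrices met by the inverse. Minors starting in row \<open>k\<close> are then upper unitriangular.
  For \<open>k \<ge> n\<close> only lower triangularity remains, so \<open>k\<close> may be replaced
  by \<open>min k n\<close>.\<close>

definition banded :: "nat \<Rightarrow> nat \<Rightarrow> (nat \<Rightarrow> nat \<Rightarrow> complex) \<Rightarrow> bool" where
  "banded n k A \<longleftrightarrow> (\<forall>r c. r < n \<longrightarrow> c < n \<longrightarrow>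
     (r < c \<or> c + k < r \<longrightarrow> A r c = 0) \<and> (r = c + k \<longrightarrow> A r c = 1))"

lemma wprod_upper: "r < c \<Longrightarrow> wprod x k r c = 0"
  by (induction k arbitrary: c) auto

lemma wprod_lower: "c + k < r \<Longrightarrow> wprod x k r c = 0"
  by (induction k arbitrary: c) auto

lemma wprod_band: "wprod x k (c + k) c = 1"
proof (induction k arbitrary: c)
  case (Suc k)
  then show ?case using Suc[of "Suc c"] by (simp add: wprod_lower)
qed auto

lemma banded_wprod: "banded n k (wprod x k)"
  by (auto simp: banded_def wprod_upper wprod_lower wprod_band)

lemma wprod_diag: "wprod x k c c = (\<Prod>i\<in>{1..k}. x i (Suc c))"
  by (induction k) (auto simp: wprod_upper)

text \<open>The entry is a sum over lattice paths descending from \<open>r\<close> to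
  \<open>c\<close>, which read only columns \<open>c + 1\<close> to \<open>r + 1\<close> of the
  array. Hence arrays may be truncated without changing a minor.\<close>

lemma wprod_cong:
  assumes "\<And>i j. 1 \<le> i \<Longrightarrow> i \<le> k \<Longrightarrow> c < j \<Longrightarrow> j \<le> Suc r \<Longrightarrow> x i j = y i j"
  shows "wprod x k r c = wprod y k r c"
  using assms
proof (induction k arbitrary: c)
  case (Suc k)
  have "wprod x k r c * x (Suc k) (Suc c) = wprod y k r c * y (Suc k) (Suc c)"
    using Suc by (cases "r < c") (auto simp: wprod_upper)
  moreover have "wprod x k r (Suc c) = wprod y k r (Suc c)"
    using Suc by auto
  ultimately show ?case by simp
qed auto

lemma dim_Mprod: "Mprod n x k \<in> carrier_mat n n"
  by (induction k) (auto simp: Wmat_def)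

lemma Mprod_wprod: "Mprod n x k = mat n n (\<lambda>(r, c). wprod x k r c)"
proof (induction k)
  case (Suc k)
  have "(\<Sum>i = 0..<n. wprod x k r i * (if i = c then x (Suc k) (i + 1) else if i = c + 1 then 1 else 0))
      = wprod x k r c * x (Suc k) (Suc c) + wprod x k r (Suc c)" if "r < n" "c < n" for r c
  proof -
    have "(\<Sum>i = 0..<n. wprod x k r i * (if i = c then x (Suc k) (i + 1) else if i = c + 1 then 1 else 0))
      = (\<Sum>i = 0..<n. (if i = c then wprod x k r i * x (Suc k) (Suc i) else 0) + (if i = Suc c then wprod x k r i else 0))"
      by (intro sum.cong) auto
    also have "\<dots> = wprod x k r c * x (Suc k) (Suc c) + (if Suc c < n then wprod x k r (Suc c) else 0)"
      using that by (subst sum.distrib) simp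
    also have "\<dots> = wprod x k r c * x (Suc k) (Suc c) + wprod x k r (Suc c)"
      using that by (auto simp: wprod_upper)
    finally show ?thesis .
  qed
  then show ?case
    by (intro eq_matI) (auto simp: Suc.IH Wmat_def scalar_prod_def)
qed (auto intro!: eq_matI)

lemma delta_int_flag_minor:
  assumes "\<And>r c. r < n \<Longrightarrow> c < n \<Longrightarrow> A $$ (r, c) = B r c" "1 \<le> i" "j \<le> n"
  shows "delta_int A i j = flag_minor B (i - 1) (Suc j - i)"
  unfolding delta_int_def flag_minor_def Let_def using assms
  by (intro arg_cong[of _ _ det] eq_matI) auto

lemma delta_int_Mprod:
  "1 \<le> i \<Longrightarrow> j \<le> n \<Longrightarrow> delta_int (Mprod n x k) i j = flag_minor (wprod x k) (i - 1) (Suc j - i)"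
  by (rule delta_int_flag_minor) (auto simp: Mprod_wprod)

lemma flag_minor_cong:
  assumes "\<And>r c. r < s \<Longrightarrow> c < s \<Longrightarrow> A (t + r) c = B (t + r) c"
  shows "flag_minor A t s = flag_minor B t s"
  unfolding flag_minor_def using assms by (intro arg_cong[of _ _ det] eq_matI) auto

lemma flag_minor_0 [simp]: "flag_minor A t 0 = 1"
  by (simp add: flag_minor_def)

lemma prod_list_diag_mat: "prod_list (diag_mat (mat s s f)) = (\<Prod>i<s. f (i, i))"
proof -
  have "prod_list (diag_mat (mat s s f)) = prod_list (map (\<lambda>i. f (i, i)) [0..<s])"
    unfolding diag_mat_def by (intro arg_cong[of _ _ prod_list]) auto
  also have "\<dots> = (\<Prod>i<s. f (i, i))"
    by (simp add: prod.list_conv_set_nth atLeast0LessThan)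
  finally show ?thesis .
qed

lemma det_mat_lower_triangular:
  assumes "\<And>i j. i < j \<Longrightarrow> j < s \<Longrightarrow> f (i, j) = (0 :: complex)"
  shows "det (mat s s f) = (\<Prod>i<s. f (i, i))"
  by (subst det_lower_triangular[where n = s]) (auto simp: assms prod_list_diag_mat)

lemma det_mat_upper_triangular:
  assumes "\<And>i j. j < i \<Longrightarrow> i < s \<Longrightarrow> f (i, j) = (0 :: complex)"
  shows "det (mat s s f) = (\<Prod>i<s. f (i, i))"
  by (subst det_upper_triangular[where n = s]) (auto simp: assms prod_list_diag_mat upper_triangular_def)

lemma flag_minor_banded:
  assumes "banded n k A" "k + s \<le> n"
  shows "flag_minor A k s = 1"
proof -
  have "A (k + i) i = 1" if "i < s" for i
    using assms that unfolding banded_def by (metis add.commute add_lessD1 nat_add_left_cancel_less order_less_le_trans)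
  moreover have "A (k + i) j = 0" if "j < i" "i < s" for i j
    using assms that unfolding banded_def by auto
  ultimately show ?thesis
    unfolding flag_minor_def by (subst det_mat_upper_triangular) auto
qed

text \<open>A discrete conservation law on the lattice: it says that the columns of the extended matrix of
  \<open>x\<close> are orthogonal, up to signs, to the vectors of first columns of the partial products of the
  transposed array.\<close>

lemma wprod_transpose_relation:
  assumes "c + k < L"
  shows "(\<Sum>a<L. (-1) ^ a * wprod (\<lambda>i j. x j i) a i 0 * wprod x k a c)
       = (-1) ^ (c + k) * wprod (\<lambda>i j. x j i) c i k"
  using assms
proof (induction k arbitrary: c)
  case 0
  then have "(\<Sum>a<L. (-1) ^ a * wprod (\<lambda>i j. x j i) a i 0 * of_bool (a = c))
     = (\<Sum>a<L. if a = c then (-1) ^ a * wprod (\<lambda>i j. x j i) a i 0 else 0)"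
    by (intro sum.cong) auto
  with 0 show ?case by simp
next
  case (Suc k)
  let ?y = "\<lambda>i j. x j i"
  have "(\<Sum>a<L. (-1) ^ a * wprod ?y a i 0 * wprod x (Suc k) a c) =
     x (Suc k) (Suc c) * (\<Sum>a<L. (-1) ^ a * wprod ?y a i 0 * wprod x k a c) +
     (\<Sum>a<L. (-1) ^ a * wprod ?y a i 0 * wprod x k a (Suc c))"
    unfolding sum_distrib_left by (subst sum.distrib[symmetric]) (simp add: algebra_simps)
  also have "\<dots> = (-1) ^ (c + Suc k) * wprod ?y c i (Suc k)"
    using Suc by (simp add: algebra_simps)
  finally show ?case .
qed

text \<open>A factor with zero diagonal is a pure shift, so appending \<open>c\<close> of them
  brings column \<open>c\<close> into column 0. Thus a whole matrix appears among the first columns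
  of successive products.\<close>

lemma wprod_zero_tail:
  assumes "\<And>i j. i > n \<Longrightarrow> x i j = 0"
  shows "wprod x (n + c) i 0 = wprod x n i c"
proof -
  have "wprod x (n + c) i j = wprod x n i (c + j)" for j
    by (induction c arbitrary: j) (auto simp: assms)
  from this[of 0] show ?thesis by simp
qed

lemma det_mat_sign_conj:
  "det (mat s s (\<lambda>(r, c). (-1) ^ (r + c) * f r c)) = det (mat s s (\<lambda>(r, c). f r c :: complex))"
proof -
  define J where "J = mat s s (\<lambda>(r, c). if r = c then (-1) ^ r else 0 :: complex)"
  let ?F = "mat s s (\<lambda>(r, c). f r c)"
  have J: "J \<in> carrier_mat s s" by (simp add: J_def)
  have row: "(\<Sum>k = 0..<s. (if r = k then (-1) ^ r else 0) * g k) = (-1) ^ r * g r" if "r < s"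
    for r and g :: "nat \<Rightarrow> complex"
  proof -
    have "(\<Sum>k = 0..<s. (if r = k then (-1) ^ r else 0) * g k) = (\<Sum>k = 0..<s. if r = k then (-1) ^ r * g k else 0)"
      by (intro sum.cong) auto
    with that show ?thesis by simp
  qed
  have col: "(\<Sum>k = 0..<s. g k * (if k = c then (-1) ^ k else 0)) = g c * (-1) ^ c" if "c < s"
    for c and g :: "nat \<Rightarrow> complex"
  proof -
    have "(\<Sum>k = 0..<s. g k * (if k = c then (-1) ^ k else 0)) = (\<Sum>k = 0..<s. if k = c then g k * (-1) ^ k else 0)"
      by (intro sum.cong) auto
    with that show ?thesis by simp
  qed
  have JM: "J * A = mat s s (\<lambda>(r, c). (-1) ^ r * A $$ (r, c))" if "A \<in> carrier_mat s s" for A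
    using that by (intro eq_matI) (auto simp: J_def scalar_prod_def row)
  have MJ: "A * J = mat s s (\<lambda>(r, c). A $$ (r, c) * (-1) ^ c)" if "A \<in> carrier_mat s s" for A
    using that by (intro eq_matI) (auto simp: J_def scalar_prod_def col)
  have "J * J = 1\<^sub>m s"
    by (subst JM[OF J]) (auto intro!: eq_matI simp: J_def power_add[symmetric])
  then have JJ: "det J * det J = 1"
    using det_mult[OF J J] by simp
  have "mat s s (\<lambda>(r, c). (-1) ^ (r + c) * f r c) = J * ?F * J"
    using J by (subst MJ, simp, subst JM, simp) (auto intro!: eq_matI simp: power_add)
  also have "det \<dots> = det J * det J * det ?F"
    using J by (simp add: det_mult[of _ s])
  finally show ?thesis using JJ by simp
qed


lemma sum_lessThan_add:
  fixes t s :: nat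
  shows "(\<Sum>a<t + s. f a) = (\<Sum>a<t. f a) + (\<Sum>a<s. f (t + a) :: complex)"
  by (induction s) (auto simp: algebra_simps)

text \<open>Pluecker duality: a matrix and the matrix of its linear relations have, up to sign, equal
  complementary minors. Here both are normalised by a unitriangular block.\<close>

lemma flag_minor_transpose:
  assumes "t \<le> m" "t \<le> n"
  shows "flag_minor (wprod x m) t (n - t) = flag_minor (wprod (\<lambda>i j. x j i) n) t (m - t)"
proof -
  define k l where "k = n - t" and "l = m - t"
  then have n: "n = t + k" and m: "m = t + l" using assms by auto
  \<comment> \<open>Zero entries outside the \<open>m\<close> by \<open>n\<close> rectangle leave
    both minors unchanged and turn all later factors into shifts, as \<open>wprod_zero_tail\<close>
    requires.\<close>
  define x' where "x' = (\<lambda>i j. if i \<le> m \<and> j \<le> n then x i j else 0)"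
  let ?y = "\<lambda>i j. x' j i"
  define H where "H = wprod x' m"
  define G where "G = (\<lambda>a i. wprod ?y a i 0)"
  define N where "N = (\<lambda>a c. (-1) ^ (a + c) * H (t + a) c)"
  \<comment> \<open>\<open>Y\<close> completes the relations \<open>G\<close> by rows that select
    the first \<open>k\<close> coordinates, and \<open>B\<close> completes \<open>N\<close> by unit
    columns. Their product is block lower triangular with the minor of \<open>H\<close> in its last
    block, while \<open>det Y\<close> is the minor of the transposed array up to sign.\<close>
  define Y where "Y = mat (l + k) (l + k) (\<lambda>(r, a). if r < l then G (t + a) (t + r) else of_bool (a = r - l))"
  define B where "B = mat (l + k) (l + k) (\<lambda>(r, c). if c < l then of_bool (r = c) else N r (c - l))"
  \<comment> \<open>In \<open>wprod_transpose_relation\<close> the right-hand side lies above the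
    diagonal because \<open>t + i < m\<close>, and the band annihilates the first \<open>t\<close>
    summands.\<close>
  have "(\<Sum>a<l + k. G (t + a) (t + i) * N a c) = 0" if "i < l" "c < k" for i c
  proof -
    have "(\<Sum>a<t + (l + k). (-1) ^ a * G a (t + i) * H a c) = 0"
      using that wprod_transpose_relation[of c m "t + (l + k)" x' "t + i"]
      by (simp add: G_def H_def wprod_upper m)
    moreover have "(\<Sum>a<t. (-1) ^ a * G a (t + i) * H a c) = 0"
      by (intro sum.neutral) (auto simp: G_def wprod_lower)
    ultimately have "0 = (\<Sum>a<l + k. (-1) ^ (t + a) * G (t + a) (t + i) * H (t + a) c)"
      unfolding sum_lessThan_add by simp
    also have "\<dots> = (-1) ^ t * (-1) ^ c * (\<Sum>a<l + k. G (t + a) (t + i) * N a c)"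
      unfolding N_def sum_distrib_left by (intro sum.cong) (auto simp: power_add)
    finally show ?thesis by simp
  qed
  then have orth: "(\<Sum>a = 0..<l + k. G (t + a) (t + i) * N a c) = 0" if "i < l" "c < k" for i c
    using that by (simp add: atLeast0LessThan)
  have left: "(\<Sum>a = 0..<l + k. f a * of_bool (a = c)) = f c" if "c < l + k" for c and f :: "nat \<Rightarrow> complex"
    using that by (simp add: of_bool_def if_distrib[of "\<lambda>z. _ * z"] cong: if_cong)
  have right: "(\<Sum>a = 0..<l + k. of_bool (a = c) * f a) = f c" if "c < l + k" for c and f :: "nat \<Rightarrow> complex"
    using left[OF that, of f] by (simp add: mult.commute)
  let ?T = "mat l l (\<lambda>(r, c). G (t + c) (t + r))"
  let ?E = "mat k k (\<lambda>(r, c). N r c)"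
  have "Y * B = four_block_mat ?T (0\<^sub>m l k) (mat k l (\<lambda>(r, c). of_bool (r = c))) ?E"
    by (rule eq_matI) (auto simp: Y_def B_def scalar_prod_def orth left right)
  then have "det (Y * B) = det ?T * det ?E"
    by (simp add: det_four_block_mat_upper_right_zero[of _ l _ k])
  moreover have "det ?T = 1"
    by (subst det_mat_upper_triangular) (auto simp: G_def wprod_lower wprod_band[of _ _ 0, simplified])
  moreover have "det ?E = flag_minor H t k"
    unfolding N_def flag_minor_def by (rule det_mat_sign_conj)
  moreover have "det (Y * B) = det Y * det B"
    by (rule det_mult) (auto simp: Y_def B_def)
  moreover have "det B = (-1) ^ (l * k)"
  proof -
    have N0: "N r c = 0" if "c + l < r" for r c
      using that by (auto simp: N_def H_def m wprod_lower)
    have N1: "N (l + c) c = (-1) ^ l" for c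
      using wprod_band[of x' m c] by (simp add: N_def H_def m power_add ac_simps)
    have "det B = (\<Prod>i<l + k. if i < l then 1 else N i (i - l))"
      unfolding B_def by (subst det_mat_upper_triangular) (auto intro!: prod.cong N0)
    also have "\<dots> = (\<Prod>i<l + k. if i < l then 1 else (-1) ^ l)"
      using N1 by (intro prod.cong) (auto simp: le_iff_add not_less)
    also have "\<dots> = (-1) ^ (l * k)"
      by (induction k) (auto simp: power_mult power_add)
    finally show ?thesis .
  qed
  moreover have "det Y = (-1) ^ (l * k) * flag_minor (wprod ?y n) t l"
  proof -
    let ?D = "mat l l (\<lambda>(r, c). wprod ?y n (t + r) c)"
    let ?U = "mat l k (\<lambda>(r, a). G (t + a) (t + r))"
    \<comment> \<open>The last \<open>l\<close> columns of \<open>Y\<close> lie beyond factor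
      \<open>n\<close> and so list the columns of \<open>wprod ?y n\<close>. Moving them to the
      front costs a sign that cancels the one in \<open>det B\<close>.\<close>
    have D: "G (t + (k + c)) i = wprod ?y n i c" for c i
      using wprod_zero_tail[of n ?y c i] by (simp add: G_def n x'_def add.assoc)
    have "det Y = (-1) ^ (l * k) * det (mat (l + k) (l + k) (\<lambda>(i, j). Y $$ (i, if j < l then j + k else j - l)))"
      by (rule det_swap_cols) (auto simp: Y_def)
    also have "mat (l + k) (l + k) (\<lambda>(i, j). Y $$ (i, if j < l then j + k else j - l))
        = four_block_mat ?D ?U (0\<^sub>m k l) (1\<^sub>m k)"
      by (rule eq_matI) (auto simp: Y_def D[unfolded add.commute[of k]] add.assoc)
    also have "det \<dots> = det ?D * det (1\<^sub>m k :: complex mat)"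
      by (rule det_four_block_mat_lower_left_zero) auto
    finally show ?thesis by (simp add: flag_minor_def mult.commute)
  qed
  ultimately have "flag_minor H t k = (-1) ^ (l * k) * flag_minor (wprod ?y n) t l * (-1) ^ (l * k)"
    by simp
  also have "\<dots> = ((-1) ^ (l * k) * (-1) ^ (l * k)) * flag_minor (wprod ?y n) t l"
    by (simp only: ac_simps)
  also have "(-1) ^ (l * k) * (-1) ^ (l * k) = (1 :: complex)"
    by (simp flip: power_mult_distrib)
  finally have "flag_minor H t k = flag_minor (wprod ?y n) t l" by simp
  moreover have "flag_minor H t k = flag_minor (wprod x m) t k"
    unfolding H_def by (intro flag_minor_cong wprod_cong) (auto simp: x'_def n)
  moreover have "flag_minor (wprod ?y n) t l = flag_minor (wprod (\<lambda>i j. x j i) n) t l"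
    by (intro flag_minor_cong wprod_cong) (auto simp: x'_def m)
  ultimately show ?thesis by (simp add: k_def l_def)
qed

section \<open>Gelfand--Tsetlin arrays as coordinates on banded matrices\<close>

lemma det_mat_bidiagonal_left:
  assumes "\<And>r c. r < s \<Longrightarrow> c < s \<Longrightarrow> g r c = d r * f r c + (if r = 0 then 0 else e r * f (r - 1) c)"
  shows "det (mat s s (\<lambda>(r, c). g r c)) = (\<Prod>r<s. d r) * det (mat s s (\<lambda>(r, c). f r c :: complex))"
proof -
  define L where "L = mat s s (\<lambda>(r, c). if c = r then d r else if Suc c = r then e r else 0)"
  have "(\<Sum>k = 0..<s. (if k = r then d r else if Suc k = r then e r else 0) * f k c) = g r c"
    if "r < s" "c < s" for r c
  proof -
    have "(\<Sum>k = 0..<s. (if k = r then d r else if Suc k = r then e r else 0) * f k c)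
        = (\<Sum>k = 0..<s. (if k = r then d r * f k c else 0) + (if k = r - 1 then (if r = 0 then 0 else e r * f k c) else 0))"
      by (intro sum.cong) auto
    with that show ?thesis by (subst assms) (auto simp: sum.distrib)
  qed
  then have "mat s s (\<lambda>(r, c). g r c) = L * mat s s (\<lambda>(r, c). f r c)"
    by (intro eq_matI) (auto simp: L_def scalar_prod_def)
  then have "det (mat s s (\<lambda>(r, c). g r c)) = det L * det (mat s s (\<lambda>(r, c). f r c))"
    by (simp add: det_mult[of _ s] L_def)
  moreover have "det L = (\<Prod>r<s. d r)"
    unfolding L_def by (subst det_mat_lower_triangular) auto
  ultimately show ?thesis by simp
qed

lemma det_mat_bidiagonal_right:
  assumes "\<And>r c. r < s \<Longrightarrow> c < s \<Longrightarrow> g r c = d c * f r c + (if c = 0 then 0 else e c * f r (c - 1))"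
  shows "det (mat s s (\<lambda>(r, c). g r c)) = (\<Prod>c<s. d c) * det (mat s s (\<lambda>(r, c). f r c :: complex))"
proof -
  have T: "det (mat s s (\<lambda>(r, c). h r c)) = det (mat s s (\<lambda>(r, c). h c r))" for h :: "nat \<Rightarrow> nat \<Rightarrow> complex"
    by (subst det_transpose[symmetric, of _ s]) (auto intro!: arg_cong[of _ _ det])
  show ?thesis
    unfolding T[of g] T[of f] by (rule det_mat_bidiagonal_left) (use assms in auto)
qed

text \<open>Laplace expansion along column \<open>q\<close>, whose cofactors ignore that column.
  Applied to the bottom right corner for \<open>P\<close> and to the top left corner for the inverse
  map.\<close>

lemma det_diff_entry:
  assumes "p < s" "q < s"
    and "\<And>r c. r < s \<Longrightarrow> c < s \<Longrightarrow> (r, c) \<noteq> (p, q) \<Longrightarrow> f r c = (g r c :: complex)"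
  shows "det (mat s s (\<lambda>(r, c). f r c)) - det (mat s s (\<lambda>(r, c). g r c))
       = (f p q - g p q) * cofactor (mat s s (\<lambda>(r, c). f r c)) p q"
proof -
  let ?F = "mat s s (\<lambda>(r, c). f r c)" and ?G = "mat s s (\<lambda>(r, c). g r c)"
  have "cofactor ?F i q = cofactor ?G i q" if "i < s" for i
    unfolding cofactor_def mat_delete_def using assms that
    by (auto intro!: arg_cong[of _ _ det] eq_matI)
  then have "det ?F - det ?G = (\<Sum>i<s. (f i q - g i q) * cofactor ?F i q)"
    using assms(2) by (simp add: laplace_expansion_column[of _ s q] sum_subtractf[symmetric] algebra_simps)
  also have "\<dots> = (\<Sum>i<s. if i = p then (f p q - g p q) * cofactor ?F p q else 0)"
    using assms by (intro sum.cong) auto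
  finally show ?thesis using assms(1) by simp
qed

lemma cofactor_last:
  "cofactor (mat (Suc s) (Suc s) (\<lambda>(r, c). f r c)) s s = det (mat s s (\<lambda>(r, c). f r c))"
  unfolding cofactor_def mat_delete_def
  by (auto intro!: arg_cong[of _ _ det] eq_matI simp: power_add[symmetric])

lemma cofactor_first:
  "cofactor (mat (Suc s) (Suc s) (\<lambda>(r, c). f r c)) 0 0 = det (mat s s (\<lambda>(r, c). f (Suc r) (Suc c)))"
  unfolding cofactor_def mat_delete_def
  by (auto intro!: arg_cong[of _ _ det] eq_matI)

text \<open>The minor with bottom right entry \<open>(r, c)\<close> is affine in that entry, with a smaller flag minor as
  its slope.\<close>

lemma banded_eqI_flag_minors:
  assumes A: "banded n p A" and B: "banded n p B"
    and eq: "\<And>t s. t < p \<Longrightarrow> t + s \<le> n \<Longrightarrow> flag_minor A t s = flag_minor B t s"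
    and nz: "\<And>t s. t < p \<Longrightarrow> t + s \<le> n \<Longrightarrow> flag_minor A t s \<noteq> 0"
    and "r < n" "c < n"
  shows "A r c = B r c"
  using assms(5,6)
proof (induction "r + c" arbitrary: r c rule: less_induct)
  case less
  show ?case
  proof (cases "r < c \<or> c + p \<le> r")
    case True
    then consider "r < c" | "r = c + p" | "c + p < r" by linarith
    then show ?thesis using A B less.prems unfolding banded_def by cases metis+
  next
    case False
    define t where "t = r - c"
    have r: "r = t + c" and t: "t < p" using False by (auto simp: t_def)
    have "flag_minor A t (Suc c) - flag_minor B t (Suc c) =
      (A (t + c) c - B (t + c) c) * cofactor (mat (Suc c) (Suc c) (\<lambda>(r, c). A (t + r) c)) c c"
      unfolding flag_minor_def
    proof (rule det_diff_entry)
      \<comment> \<open>Every other entry of the window has a smaller index sum than its bottom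
        right corner, hence is known by induction.\<close>
      fix r' c' assume "r' < Suc c" "c' < Suc c" "(r', c') \<noteq> (c, c)"
      then show "A (t + r') c' = B (t + r') c'"
        using less.hyps[of "t + r'" c'] less.prems r by auto
    qed auto
    also have "cofactor (mat (Suc c) (Suc c) (\<lambda>(r, c). A (t + r) c)) c c = flag_minor A t c"
      unfolding flag_minor_def by (rule cofactor_last)
    finally show ?thesis
      using eq[OF t, of "Suc c"] nz[OF t, of c] less.prems r by auto
  qed
qed

text \<open>Entries of the product defining \<open>Phi\<close>. New factors multiply from the left,
  so the recursion runs over rows.\<close>

fun gt_prod :: "(nat \<Rightarrow> nat \<Rightarrow> complex) \<Rightarrow> nat \<Rightarrow> nat \<Rightarrow> nat \<Rightarrow> complex" where
  "gt_prod z 0 r c = of_bool (r = c)"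
| "gt_prod z (Suc k) r c =
     (if r < k then 1 else if r = k then z (Suc k) (Suc k) else z (Suc k) (Suc r) / z (Suc k) r)
       * gt_prod z k r c + (if k < r then gt_prod z k (r - 1) c else 0)"

lemma gt_prod_upper: "r < c \<Longrightarrow> gt_prod z k r c = 0"
  by (induction k arbitrary: r) auto

lemma gt_prod_lower: "c + k < r \<Longrightarrow> gt_prod z k r c = 0"
  by (induction k arbitrary: r) auto

lemma gt_prod_band: "gt_prod z k (c + k) c = 1"
  by (induction k) (auto simp: gt_prod_lower)

lemma banded_gt_prod: "banded n k (gt_prod z k)"
  by (auto simp: banded_def gt_prod_upper gt_prod_lower gt_prod_band)

lemma PhiProd_gt_prod: "PhiProd n z k = mat n n (\<lambda>(r, c). gt_prod z k r c)"
proof (induction k)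
  case (Suc k)
  let ?d = "\<lambda>r. if r < k then 1 else if r = k then z (Suc k) (Suc k) else z (Suc k) (Suc r) / z (Suc k) r"
  have "(\<Sum>i = 0..<n. WGT n z (Suc k) $$ (r, i) * gt_prod z k i c) = gt_prod z (Suc k) r c" if "r < n" "c < n" for r c
  proof -
    have "(\<Sum>i = 0..<n. WGT n z (Suc k) $$ (r, i) * gt_prod z k i c)
       = (\<Sum>i = 0..<n. (if i = r then ?d r * gt_prod z k i c else 0)
            + (if i = r - 1 then (if k < r then gt_prod z k i c else 0) else 0))"
      using that by (intro sum.cong) (auto simp: WGT_def)
    with that show ?thesis by (auto simp: sum.distrib)
  qed
  then show ?case
    by (intro eq_matI) (auto simp: Suc.IH scalar_prod_def WGT_def)
qed (auto intro!: eq_matI)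

lemma Phi_gt_prod: "Phi n k z = mat n n (\<lambda>(r, c). gt_prod z (min k n) r c)"
  by (simp add: Phi_def PhiProd_gt_prod)

text \<open>Each factor multiplies the minor by its diagonal product, which telescopes to a single
  array entry. Quotients of consecutive minors then return the entries of \<open>z\<close>, which is
  how \<open>Psi\<close> inverts \<open>Phi\<close>.\<close>

lemma flag_minor_gt_prod:
  assumes "\<And>i j. 1 \<le> i \<Longrightarrow> i \<le> k \<Longrightarrow> i \<le> j \<Longrightarrow> j \<le> t + s \<Longrightarrow> z i j \<noteq> 0" "t \<le> k"
  shows "flag_minor (gt_prod z k) t s = (\<Prod>i\<in>{Suc t..min k (t + s)}. z i (t + s))"
  using assms
proof (induction k)
  case 0
  then show ?case using flag_minor_banded[OF banded_gt_prod, of 0 s s z] by (simp del: gt_prod.simps)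
next
  case (Suc k)
  show ?case
  proof (cases "t = Suc k")
    case True
    then show ?thesis using flag_minor_banded[OF banded_gt_prod, of "Suc k" s "Suc k + s" z]
      by (simp del: gt_prod.simps)
  next
    case False
    with Suc.prems have t: "t \<le> k" by simp
    let ?d = "\<lambda>r. if r < k then 1 else if r = k then z (Suc k) (Suc k) else z (Suc k) (Suc r) / z (Suc k) r"
    \<comment> \<open>Since \<open>t \<le> k\<close>, the factor adds nothing from row
      \<open>t - 1\<close> to row \<open>t\<close>: the window is multiplied by a bidiagonal matrix
      of its own size.\<close>
    have "flag_minor (gt_prod z (Suc k)) t s = (\<Prod>r<s. ?d (t + r)) * flag_minor (gt_prod z k) t s"
      unfolding flag_minor_def
      by (rule det_mat_bidiagonal_left[where e = "\<lambda>r. if k < t + r then 1 else 0"]) (use t in auto)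
    moreover have "(\<Prod>r<s'. ?d (t + r)) = (if t + s' \<le> k then 1 else z (Suc k) (t + s'))" if "s' \<le> s" for s'
      using that
    proof (induction s')
      case 0 then show ?case using t by simp
    next
      case (Suc s')
      then show ?case using assms Suc.prems \<open>\<And>i j. 1 \<le> i \<Longrightarrow> i \<le> Suc k \<Longrightarrow> i \<le> j \<Longrightarrow> j \<le> t + s \<Longrightarrow> z i j \<noteq> 0\<close>[of "Suc k" "t + s'"]
        by (auto simp: not_le le_less_Suc_eq)
    qed
    moreover have "flag_minor (gt_prod z k) t s = (\<Prod>i\<in>{Suc t..min k (t + s)}. z i (t + s))"
      using Suc t by auto
    moreover have "{Suc t..min (Suc k) (t + s)} = (if t + s \<le> k then {Suc t..min k (t + s)}
        else insert (Suc k) {Suc t..min k (t + s)})"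
      using t by auto
    ultimately show ?thesis by (auto simp: min_def simp del: gt_prod.simps)
  qed
qed

lemma prod_telescope:
  assumes "t \<le> e" "\<And>l. t \<le> l \<Longrightarrow> l \<le> e \<Longrightarrow> f l \<noteq> (0 :: complex)"
  shows "(\<Prod>l\<in>{Suc t..e}. f (l - 1) / f l) = f t / f e"
  using assms by (induction e rule: dec_induct) auto

text \<open>Both matrices are banded, so it suffices to compare flag minors, and those of the
  product telescope to those of \<open>A\<close>. This is \<open>Phi\<close> after
  \<open>Psi\<close>.\<close>

lemma gt_prod_eqI:
  assumes A: "banded n p A" and p: "p \<le> n"
    and nz: "\<And>t s. t \<le> p \<Longrightarrow> t + s \<le> n \<Longrightarrow> flag_minor A t s \<noteq> 0"
    and z: "\<And>i j. 1 \<le> i \<Longrightarrow> i \<le> p \<Longrightarrow> i \<le> j \<Longrightarrow> j \<le> n \<Longrightarrow>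
      z i j = flag_minor A (i - 1) (Suc j - i) / flag_minor A i (j - i)"
    and "r < n" "c < n"
  shows "gt_prod z p r c = A r c"
proof (rule sym, rule banded_eqI_flag_minors[OF A banded_gt_prod _ _ assms(5,6)])
  fix t s assume t: "t < p" "t + s \<le> n"
  show "flag_minor A t s \<noteq> 0" using nz t by auto
  \<comment> \<open>The telescoping stops at row \<open>e\<close>, where the remaining minor is
    either empty or starts at the band; it is 1 in both cases.\<close>
  define e where "e = min p (t + s)"
  have e: "t \<le> e" "e \<le> p" "e \<le> t + s" using t by (auto simp: e_def)
  have e1: "flag_minor A e (t + s - e) = 1"
    using t flag_minor_banded[OF A, of "t + s - p"] by (auto simp: e_def min_def)
  have "flag_minor (gt_prod z p) t s = (\<Prod>i\<in>{Suc t..e}. z i (t + s))"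
    unfolding e_def using t nz z by (intro flag_minor_gt_prod) auto
  also have "\<dots> = (\<Prod>i\<in>{Suc t..e}. flag_minor A (i - 1) (t + s - (i - 1)) / flag_minor A i (t + s - i))"
    using e t z by (intro prod.cong) (auto simp: Suc_diff_le)
  also have "\<dots> = flag_minor A t (t + s - t) / flag_minor A e (t + s - e)"
    using e t nz by (intro prod_telescope[where f = "\<lambda>i. flag_minor A i (t + s - i)"]) auto
  finally show "flag_minor A t s = flag_minor (gt_prod z p) t s" by (simp add: e1)
qed

section \<open>Crystal operators\<close>

lemma sigma_Suc_length:
  "sigma (Suc L) u v c k = sigma L u v c k * u (Suc L) + (if Suc L \<le> k then c else 1) * (\<Prod>s\<in>{1..L}. v s)"
proof -
  have "(\<Prod>s\<in>{r<..Suc L}. u s) = (\<Prod>s\<in>{r<..L}. u s) * u (Suc L)" if "r \<le> L" for r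
  proof -
    have "{r<..Suc L} = insert (Suc L) {r<..L}" using that by auto
    then show ?thesis by (simp add: mult.commute)
  qed
  moreover have "{1..<Suc L} = {1..L}" by auto
  ultimately show ?thesis
    unfolding sigma_def sum_distrib_right by (simp add: mult.assoc)
qed

lemma sigma_step:
  assumes "k < L"
  shows "sigma L u v c (Suc k) = sigma L u v c k + (c - 1) * (\<Prod>s\<in>{1..k}. v s) * (\<Prod>s\<in>{Suc k<..L}. u s)"
proof -
  have *: "{1..<Suc k} = {1..k}" by auto
  have "sigma L u v c (Suc k) - sigma L u v c k =
      (\<Sum>r\<in>{1..L}. if r = Suc k then (c - 1) * (\<Prod>s\<in>{1..<Suc k}. v s) * (\<Prod>s\<in>{Suc k<..L}. u s) else 0)"
    unfolding sigma_def sum_subtractf[symmetric]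
    by (intro sum.cong) (auto simp: algebra_simps le_Suc_eq)
  from this[unfolded *] show ?thesis using assms by (simp add: algebra_simps)
qed

lemma sigma_0: "sigma L u v c 0 = sigma1 L u v"
  unfolding sigma1_def sigma_def by (intro sum.cong) auto

lemma sigma_length: "sigma L u v c L = c * sigma1 L u v"
  unfolding sigma1_def sigma_def sum_distrib_left by (intro sum.cong) auto

text \<open>A path from \<open>c + 1\<close> to \<open>c\<close> steps down in exactly one factor
  \<open>r\<close>: earlier factors contribute column \<open>c + 2\<close> of the array, later ones
  column \<open>c + 1\<close>. This is the \<open>r\<close>-th summand of
  \<open>sigma\<close>.\<close>

lemma wprod_subdiag:
  "wprod x m (Suc c) c = sigma1 m (\<lambda>a. x a (Suc c)) (\<lambda>a. x a (Suc (Suc c)))"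
proof (induction m)
  case 0
  then show ?case by (simp add: sigma1_def sigma_def)
next
  case (Suc m)
  then show ?case by (simp add: sigma1_def sigma_Suc_length wprod_diag)
qed

text \<open>The parameter of the unipotent factor after it has passed \<open>k\<close> bidiagonal
  factors. Its values at \<open>k = 0\<close> and \<open>k = L\<close> give the two unipotents in
  the operator on Gelfand-Tsetlin arrays, the second one inverted.\<close>

definition slide :: "nat \<Rightarrow> (nat \<Rightarrow> complex) \<Rightarrow> (nat \<Rightarrow> complex) \<Rightarrow> complex \<Rightarrow> nat \<Rightarrow> complex" where
  "slide L u v c k = (c - 1) * (\<Prod>s\<in>{1..k}. v s) * (\<Prod>s\<in>{k<..L}. u s) / sigma L u v c k"

text \<open>With \<open>a\<close> and \<open>a'\<close> the values of \<open>slide\<close> at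
  \<open>k\<close> and \<open>Suc k\<close>, and \<open>u'\<close>, \<open>v'\<close> the new
  entries, these are the 2 by 2 exchange relations \<open>u' = u + a\<close>,
  \<open>v = v' + a'\<close> and \<open>a * v = a' * u'\<close>. They follow from the increment of
  \<open>sigma\<close> in \<open>k\<close>.\<close>

lemma slide_step:
  assumes "k < L" "sigma L u v c k \<noteq> 0" "sigma L u v c (Suc k) \<noteq> 0"
  shows "u (Suc k) * sigma L u v c (Suc k) / sigma L u v c k = u (Suc k) + slide L u v c k"
    and "v (Suc k) = v (Suc k) * sigma L u v c k / sigma L u v c (Suc k) + slide L u v c (Suc k)"
    and "slide L u v c k * v (Suc k)
      = slide L u v c (Suc k) * (u (Suc k) * sigma L u v c (Suc k) / sigma L u v c k)"
proof -
  have "{k<..L} = insert (Suc k) {Suc k<..L}" using assms by auto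
  then have U: "(\<Prod>s\<in>{k<..L}. u s) = u (Suc k) * (\<Prod>s\<in>{Suc k<..L}. u s)" by simp
  have V: "(\<Prod>s\<in>{1..Suc k}. v s) = (\<Prod>s\<in>{1..k}. v s) * v (Suc k)" by simp
  note S = sigma_step[OF assms(1), of u v c]
  show "u (Suc k) * sigma L u v c (Suc k) / sigma L u v c k = u (Suc k) + slide L u v c k"
    unfolding slide_def U S using assms(2) by (simp add: field_simps)
  have "v (Suc k) * sigma L u v c (Suc k) = v (Suc k) * sigma L u v c k
      + (c - 1) * (\<Prod>s\<in>{1..Suc k}. v s) * (\<Prod>s\<in>{Suc k<..L}. u s)"
    unfolding S V by (simp add: algebra_simps)
  then show "v (Suc k) = v (Suc k) * sigma L u v c k / sigma L u v c (Suc k) + slide L u v c (Suc k)"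
    unfolding slide_def using assms(3) by (simp add: field_simps)
  show "slide L u v c k * v (Suc k)
      = slide L u v c (Suc k) * (u (Suc k) * sigma L u v c (Suc k) / sigma L u v c k)"
    unfolding slide_def U V using assms(2,3) by simp
qed

lemma slide_0: "slide m (\<lambda>a. x a j) (\<lambda>a. x a (j + 1)) c 0 = (c - 1) * col_phi m x j"
proof -
  have "{0<..m} = {1..m}" by auto
  then show ?thesis by (simp add: slide_def col_phi_def col_pi_def sigma_0)
qed

lemma slide_length:
  assumes "c \<noteq> 0"
  shows "slide m (\<lambda>a. x a j) (\<lambda>a. x a (j + 1)) c m = - ((inverse c - 1) * col_eps m x j)"
  using assms by (cases "sigma1 m (\<lambda>a. x a j) (\<lambda>a. x a (j + 1)) = 0")
    (simp_all add: slide_def col_eps_def col_pi_def sigma_length field_simps)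

text \<open>The relation \<open>x\<^sub>j(a) W(y) = W(y') x\<^sub>j(a')\<close> lets a unipotent factor slide through the product.\<close>

lemma wprod_col_e:
  fixes c :: complex
  assumes j: "1 \<le> j"
    and \<sigma>: "\<forall>k\<le>m. sigma m (\<lambda>a. x a j) (\<lambda>a. x a (j + 1)) c k \<noteq> 0"
    and "k \<le> m"
  defines "y \<equiv> col_e m j c x" and "a \<equiv> slide m (\<lambda>a. x a j) (\<lambda>a. x a (j + 1)) c"
  shows "wprod y k r d + (if d = j then a k * wprod y k r (j - 1) else 0)
       = wprod x k r d + (if Suc r = j then a 0 * wprod x k j d else 0)"
  using \<open>k \<le> m\<close>
proof (induction k arbitrary: d)
  case 0
  then show ?case using j by auto
next
  case (Suc k)
  let ?s = "sigma m (\<lambda>a. x a j) (\<lambda>a. x a (j + 1)) c"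
  let ?b = "x (Suc k)"
  have k: "k < m" "?s k \<noteq> 0" "?s (Suc k) \<noteq> 0" using Suc.prems \<sigma> by auto
  note step = slide_step[OF k]
  have y: "y (Suc k) i = (if i = j then ?b j + a k else if i = j + 1 then ?b (j + 1) - a (Suc k) else ?b i)" for i
    using step(1,2) unfolding y_def col_e_def Let_def a_def by (auto simp: algebra_simps)
  have av: "a k * ?b (j + 1) = a (Suc k) * (?b j + a k)"
    using step(1,3) unfolding a_def by metis
  have IH: "wprod x k r d + (if Suc r = j then a 0 * wprod x k j d else 0)
      = wprod y k r d + (if d = j then a k * wprod y k r (j - 1) else 0)" for d
    using Suc by simp
  have "wprod x (Suc k) r d + (if Suc r = j then a 0 * wprod x (Suc k) j d else 0)
      = (wprod x k r d + (if Suc r = j then a 0 * wprod x k j d else 0)) * ?b (Suc d)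
      + (wprod x k r (Suc d) + (if Suc r = j then a 0 * wprod x k j (Suc d) else 0))"
    by (simp add: algebra_simps)
  also have "\<dots> = (wprod y k r d + (if d = j then a k * wprod y k r (j - 1) else 0)) * ?b (Suc d)
      + (wprod y k r (Suc d) + (if Suc d = j then a k * wprod y k r (j - 1) else 0))"
    by (simp only: IH)
  also have "\<dots> = wprod y (Suc k) r d + (if d = j then a (Suc k) * wprod y (Suc k) r (j - 1) else 0)"
  proof -
    consider "d = j" | "Suc d = j" | "d \<noteq> j" "Suc d \<noteq> j" by blast
    then show ?thesis
    proof cases
      case 1
      have "a k * wprod y k r (j - 1) * ?b (j + 1) = a (Suc k) * (?b j + a k) * wprod y k r (j - 1)"
        using av by (metis mult.assoc mult.commute)
      then show ?thesis using 1 j by (simp add: y algebra_simps)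
    qed (use j in \<open>auto simp: y algebra_simps\<close>)
  qed
  finally show ?case by simp
qed

text \<open>Row \<open>j\<close> is added to the row above it, so only a window ending exactly at
  row \<open>j - 1\<close> can be affected. Windows reaching the bottom, which give
  \<open>Q\<close>, never end there for \<open>j < n\<close>.\<close>

lemma flag_minor_addrow:
  assumes "\<And>r c. c < s \<Longrightarrow> B r c = A r c + (if Suc r = j then a * A j c else 0)" "j < t + s"
  shows "flag_minor B t s = flag_minor A t s"
proof (cases "Suc t \<le> j")
  case True
  have "mat s s (\<lambda>(r, c). B (t + r) c) = addrow a (j - 1 - t) (j - t) (mat s s (\<lambda>(r, c). A (t + r) c))"
    using True assms by (intro eq_matI) auto
  then show ?thesis
    unfolding flag_minor_def using True assms(2) by (simp add: det_addrow[of _ s])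
next
  case False
  with assms(1) show ?thesis by (intro flag_minor_cong) auto
qed

lemma flag_minor_addcol:
  assumes "\<And>r c. B r c = A r c + (if c = j then a * A r (j - 1) else 0)" "1 \<le> j"
  shows "flag_minor B t s = flag_minor A t s"
  unfolding flag_minor_def
  by (subst det_mat_bidiagonal_right[where d = "\<lambda>_. 1" and e = "\<lambda>c. if c = j then a else 0"
        and f = "\<lambda>r c. A (t + r) c"]) (use assms in auto)

lemma flag_minor_col_e:
  assumes "1 \<le> j" "j < t + s" "k \<le> m"
    and "\<forall>k\<le>m. sigma m (\<lambda>a. x a j) (\<lambda>a. x a (j + 1)) c k \<noteq> 0"
  shows "flag_minor (wprod (col_e m j c x) k) t s = flag_minor (wprod x k) t s"
proof -
  let ?a = "slide m (\<lambda>a. x a j) (\<lambda>a. x a (j + 1)) c" and ?y = "col_e m j c x"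
  have "flag_minor (wprod ?y k) t s =
      flag_minor (\<lambda>r d. wprod ?y k r d + (if d = j then ?a k * wprod ?y k r (j - 1) else 0)) t s"
    by (rule flag_minor_addcol[symmetric]) (use assms in auto)
  also have "\<dots> = flag_minor (wprod x k) t s"
    using wprod_col_e[OF assms(1,4,3)] assms(2)
    by (intro flag_minor_addrow[where a = "?a 0" and j = j]) auto
  finally show ?thesis .
qed

lemma gRSK_Q_flag_minor:
  assumes "1 \<le> j" "j \<le> n"
  shows "gRSK_Q m n x j i = flag_minor (wprod x i) (j - 1) (Suc n - j) / flag_minor (wprod x i) j (n - j)"
  using assms by (simp add: gRSK_Q_def delta_int_Mprod)

lemma gRSK_P_flag_minor:
  assumes "1 \<le> i" "i \<le> j" "j \<le> n"
  shows "gRSK_P m n x i j = flag_minor (wprod x m) (i - 1) (Suc j - i) / flag_minor (wprod x m) i (j - i)"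
  using assms by (simp add: gRSK_P_def Psi_def delta_int_Mprod)

lemma gRSK_Q_col_e:
  assumes "1 \<le> j" "j < n" "1 \<le> j'" "j' \<le> n" "i \<le> m"
    and "\<forall>k\<le>m. sigma m (\<lambda>a. x a j) (\<lambda>a. x a (j + 1)) c k \<noteq> 0"
  shows "gRSK_Q m n (col_e m j c x) j' i = gRSK_Q m n x j' i"
  using assms by (simp add: gRSK_Q_flag_minor flag_minor_col_e)

lemma index_xj_mult:
  assumes "A \<in> carrier_mat n n" "1 \<le> j" "j < n" "r < n" "d < n"
  shows "(xj n j a * A) $$ (r, d) = A $$ (r, d) + (if Suc r = j then a * A $$ (j, d) else 0)"
proof -
  have "(xj n j a * A) $$ (r, d) =
      (\<Sum>k = 0..<n. (if k = r then A $$ (k, d) else 0) + (if k = j then (if Suc r = j then a * A $$ (k, d) else 0) else 0))"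
    using assms by (auto simp: xj_def scalar_prod_def intro!: sum.cong)
  with assms show ?thesis by (simp add: sum.distrib)
qed

lemma index_mult_xj:
  assumes "A \<in> carrier_mat n n" "1 \<le> j" "j < n" "r < n" "d < n"
  shows "(A * xj n j a) $$ (r, d) = A $$ (r, d) + (if d = j then a * A $$ (r, j - 1) else 0)"
proof -
  have "(A * xj n j a) $$ (r, d) =
      (\<Sum>k = 0..<n. (if k = d then A $$ (r, k) else 0) + (if k = j - 1 then (if d = j then a * A $$ (r, k) else 0) else 0))"
    using assms by (auto simp: xj_def scalar_prod_def intro!: sum.cong)
  with assms show ?thesis by (auto simp: sum.distrib)
qed

lemma Mprod_col_e:
  assumes j: "1 \<le> j" "j < n" and c: "c \<noteq> 0"
    and \<sigma>: "\<forall>k\<le>m. sigma m (\<lambda>a. x a j) (\<lambda>a. x a (j + 1)) c k \<noteq> 0"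
  shows "Mprod n (col_e m j c x) m
    = xj n j ((c - 1) * col_phi m x j) * Mprod n x m * xj n j ((inverse c - 1) * col_eps m x j)"
proof (rule eq_matI)
  let ?a = "slide m (\<lambda>a. x a j) (\<lambda>a. x a (j + 1)) c" and ?y = "col_e m j c x"
  let ?B = "xj n j ((c - 1) * col_phi m x j) * Mprod n x m"
  have xj: "xj n j b \<in> carrier_mat n n" for b by (simp add: xj_def)
  have B: "?B \<in> carrier_mat n n" using xj dim_Mprod by (rule mult_carrier_mat)
  fix r d assume "r < dim_row (?B * xj n j ((inverse c - 1) * col_eps m x j))"
    "d < dim_col (?B * xj n j ((inverse c - 1) * col_eps m x j))"
  then have rd: "r < n" "d < n" by (auto simp: xj_def)
  have Bi: "?B $$ (r, d) = wprod ?y m r d + (if d = j then ?a m * wprod ?y m r (j - 1) else 0)" if "d < n" for d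
    unfolding wprod_col_e[OF j(1) \<sigma> order_refl] slide_0 using rd that j
    by (subst index_xj_mult[OF dim_Mprod j]) (auto simp: Mprod_wprod)
  \<comment> \<open>By \<open>slide_length\<close> the right-hand factor has parameter
    \<open>- ?a m\<close> and cancels the unipotent that emerges on the right.\<close>
  show "Mprod n ?y m $$ (r, d) = (?B * xj n j ((inverse c - 1) * col_eps m x j)) $$ (r, d)"
    using rd j Bi[of d] Bi[of "j - 1"] slide_length[OF c, of m x j]
    by (subst index_mult_xj[OF B j]) (auto simp: Mprod_wprod)
qed (auto simp: Mprod_wprod xj_def)

text \<open>The hypothesis only asks that \<open>Phi\<close> of \<open>z\<close> be the product
  matrix, not that \<open>z\<close> be \<open>P\<close> itself. Hence it also applies to
  \<open>Q\<close> and the transposed array.\<close>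

lemma gt_structure:
  assumes z: "\<And>r c. r < n \<Longrightarrow> c < n \<Longrightarrow> gt_prod z (min m n) r c = wprod x m r c"
  shows "1 \<le> k \<Longrightarrow> k \<le> n \<Longrightarrow> gt_gamma n m z k = col_pi m x k"
    and "1 \<le> j \<Longrightarrow> j < n \<Longrightarrow> gt_eps n m z j = col_eps m x j"
    and "1 \<le> j \<Longrightarrow> j < n \<Longrightarrow> gt_phi n m z j = col_phi m x j"
    and "1 \<le> j \<Longrightarrow> j < n \<Longrightarrow> c \<noteq> 0 \<Longrightarrow>
      (\<forall>k\<le>m. sigma m (\<lambda>a. x a j) (\<lambda>a. x a (j + 1)) c k \<noteq> 0) \<Longrightarrow>
      gt_e n m j c z = gRSK_P m n (col_e m j c x)"
proof -
  have \<Phi>: "Phi n m z = Mprod n x m"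
    unfolding Phi_gt_prod Mprod_wprod using z by (intro eq_matI) auto
  have sub: "wprod x m j (j - 1) = sigma1 m (\<lambda>a. x a j) (\<lambda>a. x a (j + 1))" if "1 \<le> j" for j
    using wprod_subdiag[of x m "j - 1"] that by simp
  show "gt_gamma n m z k = col_pi m x k" if "1 \<le> k" "k \<le> n" for k
    using that by (simp add: gt_gamma_def \<Phi> Mprod_wprod wprod_diag col_pi_def)
  show eps: "gt_eps n m z j = col_eps m x j" if "1 \<le> j" "j < n" for j
    using that sub[of j] by (simp add: gt_eps_def \<Phi> Mprod_wprod wprod_diag col_eps_def col_pi_def)
  show phi: "gt_phi n m z j = col_phi m x j" if "1 \<le> j" "j < n" for j
    using that sub[of j] by (simp add: gt_phi_def \<Phi> Mprod_wprod wprod_diag col_phi_def col_pi_def)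
  show "gt_e n m j c z = gRSK_P m n (col_e m j c x)" if "1 \<le> j" "j < n" "c \<noteq> 0"
    "\<forall>k\<le>m. sigma m (\<lambda>a. x a j) (\<lambda>a. x a (j + 1)) c k \<noteq> 0" for j c
    using that by (simp add: gt_e_def gRSK_P_def \<Phi> Mprod_col_e eps phi)
qed

section \<open>Genericity and transposition\<close>

lemma poly_in_entry: "poly_in mat_coords (\<lambda>x. x i j)"
  by (rule poly_coord) (auto simp: mat_coords_def)

lemma poly_in_wprod: "poly_in mat_coords (\<lambda>x. wprod x k r c)"
  by (induction k arbitrary: c) (auto intro!: poly_const poly_add poly_mult poly_in_entry)

lemma poly_in_flag_minor: "poly_in mat_coords (\<lambda>x. flag_minor (wprod x k) t s)"
  unfolding flag_minor_def by (intro poly_in.det poly_in_wprod)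

lemma poly_in_sigma: "poly_in mat_coords (\<lambda>x. sigma m (\<lambda>a. x a j) (\<lambda>a. x a j') c k)"
  unfolding sigma_def by (intro poly_in.sum poly_in.prod poly_mult poly_const poly_in_entry)

lemma flag_minor_ex_nonzero:
  assumes "t \<le> k"
  shows "\<exists>x. flag_minor (wprod x k) t s \<noteq> 0"
proof -
  \<comment> \<open>The first \<open>t\<close> factors are shifts, making the rows from
    \<open>t\<close> on an identity matrix; the remaining factors have unit diagonal and keep the
    window lower unitriangular.\<close>
  define x :: "nat \<Rightarrow> nat \<Rightarrow> complex" where "x = (\<lambda>i j. if i \<le> t then 0 else 1)"
  have "wprod x l r c = of_bool (r = c + l)" if "l \<le> t" for l r c
    using that by (induction l arbitrary: c) (auto simp: x_def)
  then have t: "wprod x t (t + r) c = of_bool (r = c)" for r c by auto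
  have x1: "x (Suc (t + l)) j = 1" for l j by (simp add: x_def)
  have "wprod x (t + l) (t + c) c = 1 \<and> (\<forall>r<c. wprod x (t + l) (t + r) c = 0)" for l c
    by (induction l arbitrary: c) (auto simp: t x1)
  from this[of "k - t"] assms have
    "wprod x k (t + c) c = 1" "r < c \<Longrightarrow> wprod x k (t + r) c = 0" for r c by auto
  then have "flag_minor (wprod x k) t s = 1"
    unfolding flag_minor_def by (subst det_mat_lower_triangular) auto
  then show ?thesis by (intro exI[of _ x]) simp
qed

text \<open>For \<open>t > k\<close> and \<open>s > 0\<close> the minor has a zero first column, so
  the bound \<open>t \<le> k\<close> cannot be relaxed. On the torus these conditions make all
  denominators of \<open>P\<close>, \<open>Q\<close> and of the inverse at the image of
  \<open>x\<close> nonzero.\<close>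

definition nondegenerate :: "nat \<Rightarrow> nat \<Rightarrow> (nat \<Rightarrow> nat \<Rightarrow> complex) \<Rightarrow> bool" where
  "nondegenerate m n x \<longleftrightarrow>
     (\<forall>k\<le>m. \<forall>t\<le>k. \<forall>s. t + s \<le> n \<longrightarrow> flag_minor (wprod x k) t s \<noteq> 0)"

lemma nondegenerateD:
  "nondegenerate m n x \<Longrightarrow> k \<le> m \<Longrightarrow> t \<le> k \<Longrightarrow> t + s \<le> n \<Longrightarrow> flag_minor (wprod x k) t s \<noteq> 0"
  unfolding nondegenerate_def by blast

lemma generic_nondegenerate: "generic_on mat_coords (Mat_torus m n) (nondegenerate m n)"
proof -
  let ?I = "{(k, t, s). k \<le> m \<and> t \<le> k \<and> t + s \<le> n}"
  have "?I \<subseteq> {..m} \<times> {..m} \<times> {..n}" by auto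
  then have fin: "finite ?I" by (rule finite_subset) auto
  have "generic_on mat_coords (Mat_torus m n)
      (\<lambda>x. \<forall>i\<in>?I. flag_minor (wprod x (fst i)) (fst (snd i)) (snd (snd i)) \<noteq> 0)"
    by (rule generic_on_Mat_nonzero[OF fin]) (auto intro: poly_in_flag_minor flag_minor_ex_nonzero)
  then show ?thesis
    by (rule generic_on_mono) (auto simp: nondegenerate_def)
qed

lemma generic_sigma_nonzero:
  assumes "1 \<le> m" "c \<noteq> 0"
  shows "generic_on mat_coords (Mat_torus m n)
    (\<lambda>x. \<forall>k\<le>m. sigma m (\<lambda>a. x a j) (\<lambda>a. x a (j + 1)) c k \<noteq> 0)"
proof -
  have "\<exists>x. sigma m (\<lambda>a. x a j) (\<lambda>a. x a (j + 1)) c k \<noteq> 0" for k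
  proof -
    have prod0: "(\<Prod>s\<in>{1..<r}. 0 :: complex) = of_bool (r = 1)" if "1 \<le> r" for r :: nat
      using that by (cases "r = 1") auto
    \<comment> \<open>With \<open>v = 0\<close> only the term \<open>r = 1\<close> survives, with
      value \<open>c\<close> or 1.\<close>
    have "sigma m (\<lambda>a. 1) (\<lambda>a. 0) c k = (\<Sum>r\<in>{1..m}. if r = 1 then (if 1 \<le> k then c else 1) else 0)"
      unfolding sigma_def by (intro sum.cong) (auto simp: prod0)
    also have "\<dots> \<noteq> 0" using assms by simp
    finally show ?thesis
      by (intro exI[of _ "\<lambda>i b. if b = j then 1 else 0"]) simp
  qed
  then have "generic_on mat_coords (Mat_torus m n)
      (\<lambda>x. \<forall>k\<in>{..m}. sigma m (\<lambda>a. x a j) (\<lambda>a. x a (j + 1)) c k \<noteq> 0)"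
    by (intro generic_on_Mat_nonzero) (auto intro: poly_in_sigma)
  then show ?thesis by (rule generic_on_mono) auto
qed

text \<open>Duality is applied to the first \<open>i\<close> rows of \<open>x\<close>: bottom left
  minors of the \<open>i\<close>-th partial product become minors of rows ending at \<open>i\<close>
  for the transposed array. Numerators and denominators match separately.\<close>

lemma gRSK_Q_transp:
  assumes "1 \<le> j" "j \<le> n" "j \<le> i" "i \<le> m"
  shows "gRSK_Q m n x j i = gRSK_P n m (transp x) j i"
proof -
  have [simp]: "(\<lambda>i j. x j i) = transp x" by (simp add: transp_def fun_eq_iff)
  have "n - (j - 1) = Suc n - j" "i - (j - 1) = Suc i - j" using assms by auto
  then show ?thesis using assms flag_minor_transpose[of "j - 1" i n x] flag_minor_transpose[of j i n x]
    by (simp add: gRSK_Q_flag_minor gRSK_P_flag_minor)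
qed

lemma gt_eq_gRSK_Q: "gt_eq m n (gRSK_Q m n x) (gRSK_P n m (transp x))"
  by (auto simp: gt_eq_def gRSK_Q_transp)

lemma gt_eq_gRSK_P: "gt_eq n m (gRSK_P m n x) (gRSK_Q n m (transp x))"
  by (auto simp: gt_eq_def gRSK_Q_transp)

lemma gt_prod_gRSK_P:
  assumes "nondegenerate m n x" "gt_eq n m z (gRSK_P m n x)" "r < n" "c < n"
  shows "gt_prod z (min m n) r c = wprod x m r c"
proof (rule gt_prod_eqI[OF _ _ _ _ assms(3,4)])
  show "banded n (min m n) (wprod x m)"
    using banded_wprod[of n m x] by (cases "m \<le> n") (auto simp: banded_def)
  show "flag_minor (wprod x m) t s \<noteq> 0" if "t \<le> min m n" "t + s \<le> n" for t s
    using assms(1) that by (auto dest: nondegenerateD)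
  show "z i j = flag_minor (wprod x m) (i - 1) (Suc j - i) / flag_minor (wprod x m) i (j - i)"
    if "1 \<le> i" "i \<le> min m n" "i \<le> j" "j \<le> n" for i j
    using assms(2) that by (simp add: gt_eq_def gRSK_P_flag_minor)
qed simp

lemma gRSK_in_XGT:
  assumes "nondegenerate m n x"
  shows "gRSK m n x \<in> XGT m n"
proof -
  have "gRSK_P m n x \<in> GT_torus n m"
    by (auto simp: GT_torus_def gRSK_P_flag_minor nondegenerateD[OF assms])
  moreover have "gRSK_Q m n x \<in> GT_torus m n"
    by (auto simp: GT_torus_def gRSK_Q_flag_minor nondegenerateD[OF assms])
  moreover have "gRSK_P m n x k n = gRSK_Q m n x k m" if "1 \<le> k" "k \<le> n" for k
    using that by (simp add: gRSK_P_flag_minor gRSK_Q_flag_minor)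
  ultimately show ?thesis by (simp add: gRSK_def XGT_def)
qed

lemma rat_in_gRSK:
  shows "1 \<le> i \<Longrightarrow> i \<le> j \<Longrightarrow> j \<le> n \<Longrightarrow> rat_in mat_coords (\<lambda>x. gRSK_P m n x i j)"
    and "1 \<le> j' \<Longrightarrow> j' \<le> n \<Longrightarrow> rat_in mat_coords (\<lambda>x. gRSK_Q m n x j' i')"
  by (simp_all add: gRSK_P_flag_minor gRSK_Q_flag_minor)
    (intro rat_in_divide poly_in_imp_rat_in poly_in_flag_minor)+

text \<open>Quantifying over \<open>z\<close> prepares the transposition: there \<open>z\<close>
  becomes \<open>Q\<close>, which agrees with \<open>P\<close> of the transposed array only at the
  indices of a Gelfand-Tsetlin array.\<close>

lemma generic_gamma:
  "generic_on mat_coords (Mat_torus m n)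
     (\<lambda>x. \<forall>z. gt_eq n m z (gRSK_P m n x) \<longrightarrow> (\<forall>k. 1 \<le> k \<and> k \<le> n \<longrightarrow> col_pi m x k = gt_gamma n m z k))"
  by (rule generic_on_mono[OF generic_nondegenerate]) (auto simp: gt_structure(1) gt_prod_gRSK_P)

lemma generic_eps_phi:
  assumes "1 \<le> j" "j < n"
  shows "generic_on mat_coords (Mat_torus m n) (\<lambda>x. \<forall>z. gt_eq n m z (gRSK_P m n x) \<longrightarrow>
    col_eps m x j = gt_eps n m z j \<and> col_phi m x j = gt_phi n m z j)"
  using assms
  by (intro generic_on_mono[OF generic_nondegenerate]) (auto simp: gt_structure(2,3) gt_prod_gRSK_P)

lemma generic_col_e:
  assumes "1 \<le> m" "1 \<le> j" "j < n" "c \<noteq> 0"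
  shows "generic_on mat_coords (Mat_torus m n) (\<lambda>x. \<forall>z. gt_eq n m z (gRSK_P m n x) \<longrightarrow>
    gt_eq n m (gRSK_P m n (col_e m j c x)) (gt_e n m j c z) \<and>
    gt_eq m n (gRSK_Q m n (col_e m j c x)) (gRSK_Q m n x))"
proof (rule generic_on_mono[OF generic_on_Mat_conj[OF generic_nondegenerate
      generic_sigma_nonzero[OF assms(1,4), of n j]]], elim conjE, intro allI impI conjI)
  fix x z
  assume x: "nondegenerate m n x" "\<forall>k\<le>m. sigma m (\<lambda>a. x a j) (\<lambda>a. x a (j + 1)) c k \<noteq> 0"
    and z: "gt_eq n m z (gRSK_P m n x)"
  have "gt_e n m j c z = gRSK_P m n (col_e m j c x)"
    by (rule gt_structure(4)[OF gt_prod_gRSK_P[OF x(1) z] assms(2-4) x(2)])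
  then show "gt_eq n m (gRSK_P m n (col_e m j c x)) (gt_e n m j c z)" by (simp add: gt_eq_def)
  show "gt_eq m n (gRSK_Q m n (col_e m j c x)) (gRSK_Q m n x)"
    using gRSK_Q_col_e[OF assms(2,3) _ _ _ x(2)] by (simp add: gt_eq_def)
qed

lemma row_transp:
  "row_pi n x = col_pi n (transp x)" "row_eps n x = col_eps n (transp x)"
  "row_phi n x = col_phi n (transp x)" "transp (row_e n i c x) = col_e n i c (transp x)"
  by (auto simp: fun_eq_iff row_pi_def col_pi_def row_eps_def col_eps_def row_phi_def col_phi_def
      row_e_def col_e_def transp_def Let_def)

lemma gt_eq_sym: "gt_eq N K z w \<Longrightarrow> gt_eq N K w z"
  and gt_eq_trans: "gt_eq N K z w \<Longrightarrow> gt_eq N K w v \<Longrightarrow> gt_eq N K z v"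
  by (auto simp: gt_eq_def)

lemma generic_row_e:
  assumes "1 \<le> n" "1 \<le> i" "i < m" "c \<noteq> 0"
  shows "generic_on mat_coords (Mat_torus m n) (\<lambda>x.
    gt_eq n m (gRSK_P m n (row_e n i c x)) (gRSK_P m n x) \<and>
    gt_eq m n (gRSK_Q m n (row_e n i c x)) (gt_e m n i c (gRSK_Q m n x)))"
proof (rule generic_on_mono[OF generic_on_transp[OF generic_col_e[OF assms]]], intro conjI)
  fix x
  assume *: "\<forall>z. gt_eq m n z (gRSK_P n m (transp x)) \<longrightarrow>
    gt_eq m n (gRSK_P n m (col_e n i c (transp x))) (gt_e m n i c z) \<and>
    gt_eq n m (gRSK_Q n m (col_e n i c (transp x))) (gRSK_Q n m (transp x))"
  note * = *[rule_format, OF gt_eq_gRSK_Q, folded row_transp(4)]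
  show "gt_eq n m (gRSK_P m n (row_e n i c x)) (gRSK_P m n x)"
    using gt_eq_gRSK_P *[THEN conjunct2] by (metis gt_eq_sym gt_eq_trans)
  show "gt_eq m n (gRSK_Q m n (row_e n i c x)) (gt_e m n i c (gRSK_Q m n x))"
    using gt_eq_gRSK_Q *[THEN conjunct1] by (metis gt_eq_trans)
qed

section \<open>The inverse map\<close>

text \<open>To undo the last factor of \<open>A = A' W(y)\<close> it suffices to know the first column \<open>v\<close> of \<open>A'\<close>: then
  \<open>y\<^sub>c\<close> is forced by the triangularity of \<open>A'\<close>, column by column. The bottom left minors of \<open>A'\<close> are
  those of \<open>A\<close> shifted one column to the right and bordered by \<open>v\<close>, which are affine in the entries
  of \<open>v\<close> and determine them from the bottom up.\<close>

definition bordered :: "nat \<Rightarrow> (nat \<Rightarrow> complex) \<Rightarrow> (nat \<Rightarrow> nat \<Rightarrow> complex) \<Rightarrow> nat \<Rightarrow> complex" where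
  "bordered n v A t =
     det (mat (n - t) (n - t) (\<lambda>(r, c). if c = 0 then v (t + r) else A (t + r) (c - 1)))"

text \<open>The start is the band, and entries above it are filled in from the bottom. Entry
  \<open>t\<close> is still 0 when it is computed, so \<open>bordered n v A t\<close> is the
  constant term of the affine equation and the flag minor its slope.\<close>

fun first_column :: "nat \<Rightarrow> nat \<Rightarrow> (nat \<Rightarrow> nat \<Rightarrow> complex) \<Rightarrow> (nat \<Rightarrow> complex) \<Rightarrow> nat \<Rightarrow> nat \<Rightarrow> complex" where
  "first_column n k A \<tau> 0 = (\<lambda>r. of_bool (r = k))"
| "first_column n k A \<tau> (Suc s) = (let v = first_column n k A \<tau> s; t = min k n - Suc s in
     v(t := (\<tau> t - bordered n v A t) / flag_minor A (Suc t) (n - Suc t)))"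

text \<open>\<open>peel A v c\<close> is column \<open>c\<close> of the left factor. The quotient is
  the diagonal entry of the factor removed, read off in row \<open>c\<close>, where column
  \<open>c + 1\<close> of the left factor vanishes.\<close>

fun peel :: "(nat \<Rightarrow> nat \<Rightarrow> complex) \<Rightarrow> (nat \<Rightarrow> complex) \<Rightarrow> nat \<Rightarrow> nat \<Rightarrow> complex" where
  "peel A v 0 = v"
| "peel A v (Suc c) = (\<lambda>r. A r c - A c c / peel A v c c * peel A v c r)"

text \<open>The bottom left minor of the \<open>k\<close>-th partial product starting at row
  \<open>t\<close>, rebuilt from the quotients that \<open>Q\<close> stores.\<close>

definition shape_minor :: "nat \<Rightarrow> (nat \<Rightarrow> nat \<Rightarrow> complex) \<Rightarrow> nat \<Rightarrow> nat \<Rightarrow> complex" where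
  "shape_minor n Q k t = (\<Prod>l\<in>{Suc t..min k n}. Q l k)"

fun unwind :: "nat \<Rightarrow> nat \<Rightarrow> (nat \<Rightarrow> nat \<Rightarrow> complex) \<Rightarrow> (nat \<Rightarrow> nat \<Rightarrow> complex) \<Rightarrow> nat \<Rightarrow> nat \<Rightarrow> nat \<Rightarrow> complex" where
  "unwind m n P Q 0 = gt_prod P (min m n)"
| "unwind m n P Q (Suc d) = (let A = unwind m n P Q d; k = m - Suc d in
     (\<lambda>r c. peel A (first_column n k A (shape_minor n Q k) (min k n)) c r))"

text \<open>Diagonals of triangular matrices multiply, so an entry of \<open>x\<close> is the
  quotient of diagonal entries of two successive partial products; \<open>unwind\<close> at level
  \<open>d\<close> stands for the product of \<open>m - d\<close> factors.\<close>

definition gRSK_inv :: "nat \<Rightarrow> nat \<Rightarrow> (nat \<Rightarrow> nat \<Rightarrow> complex) \<times> (nat \<Rightarrow> nat \<Rightarrow> complex)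
    \<Rightarrow> nat \<Rightarrow> nat \<Rightarrow> complex" where
  "gRSK_inv m n y i j = unwind m n (fst y) (snd y) (m - i) (j - 1) (j - 1)
     / unwind m n (fst y) (snd y) (Suc (m - i)) (j - 1) (j - 1)"

section \<open>The triangular system for the first column\<close>

lemma bordered_cong:
  assumes "\<And>r. t \<le> r \<Longrightarrow> r < n \<Longrightarrow> v r = w r" "\<And>r c. r < n \<Longrightarrow> Suc c < n \<Longrightarrow> A r c = B r c"
  shows "bordered n v A t = bordered n w B t"
  unfolding bordered_def using assms by (intro arg_cong[of _ _ det] eq_matI) auto

lemma bordered_affine:
  assumes "t < n" "\<And>r. t < r \<Longrightarrow> r < n \<Longrightarrow> v r = w r"
  shows "bordered n v A t - bordered n w A t = (v t - w t) * flag_minor A (Suc t) (n - Suc t)"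
proof -
  let ?f = "\<lambda>v r c. if c = 0 then v (t + r) else A (t + r) (c - 1)"
  have n: "n - t = Suc (n - Suc t)" using assms by simp
  have "bordered n v A t - bordered n w A t
      = (?f v 0 0 - ?f w 0 0) * cofactor (mat (n - t) (n - t) (\<lambda>(r, c). ?f v r c)) 0 0"
    unfolding bordered_def by (rule det_diff_entry) (use assms in auto)
  also have "cofactor (mat (n - t) (n - t) (\<lambda>(r, c). ?f v r c)) 0 0 = flag_minor A (Suc t) (n - Suc t)"
    unfolding n cofactor_first flag_minor_def by simp
  finally show ?thesis by simp
qed

lemma first_column_outside:
  assumes "s \<le> min k n"
  shows "r < min k n - s \<Longrightarrow> first_column n k A \<tau> s r = 0"
    and "min k n \<le> r \<Longrightarrow> first_column n k A \<tau> s r = of_bool (r = k)"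
  using assms by (induction s) (auto simp: Let_def)

lemma bordered_first_column:
  assumes nz: "\<And>t. t < min k n \<Longrightarrow> flag_minor A (Suc t) (n - Suc t) \<noteq> 0"
    and "s \<le> min k n" "min k n - s \<le> t" "t < min k n"
  shows "bordered n (first_column n k A \<tau> s) A t = \<tau> t"
  using assms(2-)
proof (induction s)
  case (Suc s)
  define t0 where "t0 = min k n - Suc s"
  define v where "v = first_column n k A \<tau> s"
  define w where "w = first_column n k A \<tau> (Suc s)"
  have w: "w = v(t0 := (\<tau> t0 - bordered n v A t0) / flag_minor A (Suc t0) (n - Suc t0))"
    by (simp add: w_def v_def t0_def Let_def)
  have "v t0 = 0"
    unfolding v_def by (rule first_column_outside(1)) (use Suc.prems in \<open>auto simp: t0_def\<close>)
  have "bordered n w A t = \<tau> t"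
  proof (cases "t = t0")
    case True
    have "bordered n w A t0 - bordered n v A t0 = (w t0 - v t0) * flag_minor A (Suc t0) (n - Suc t0)"
      by (rule bordered_affine) (use True Suc.prems in \<open>auto simp: w\<close>)
    with \<open>v t0 = 0\<close> nz[of t0] Suc.prems True show ?thesis by (simp add: w)
  next
    case False
    then have "bordered n w A t = bordered n v A t"
      using Suc.prems by (intro bordered_cong) (auto simp: w t0_def)
    with Suc False show ?thesis by (simp add: v_def t0_def)
  qed
  then show ?case by (simp add: w_def)
qed auto

lemma first_column_unique:
  assumes nz: "\<And>t. t < min k n \<Longrightarrow> flag_minor A (Suc t) (n - Suc t) \<noteq> 0"
    and v: "\<And>t. t < min k n \<Longrightarrow> bordered n v A t = \<tau> t"
    and v_outside: "\<And>r. min k n \<le> r \<Longrightarrow> r < n \<Longrightarrow> v r = of_bool (r = k)"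
    and "r < n"
  shows "first_column n k A \<tau> (min k n) r = v r"
  using \<open>r < n\<close>
proof (induction "n - r" arbitrary: r rule: less_induct)
  case less
  let ?w = "first_column n k A \<tau> (min k n)"
  show ?case
  proof (cases "r < min k n")
    case True
    have "bordered n ?w A r - bordered n v A r = (?w r - v r) * flag_minor A (Suc r) (n - Suc r)"
      by (rule bordered_affine) (use less in auto)
    moreover have "bordered n ?w A r = \<tau> r"
      by (rule bordered_first_column[OF nz]) (use True in auto)
    ultimately show ?thesis using v[OF True] nz[OF True] by simp
  next
    case False
    then show ?thesis using v_outside[of r] first_column_outside(2)[of "min k n" k n r A \<tau>] less by simp
  qed
qed

text \<open>Column \<open>c\<close> of the bordered matrix is column \<open>c\<close> of
  \<open>A'\<close> plus a multiple of column \<open>c - 1\<close>, so unipotent column operations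
  relate the two determinants. Used both to recover a known factorisation and to create a new
  one.\<close>

lemma bordered_peel:
  assumes "\<And>r c. r < n \<Longrightarrow> Suc c < n \<Longrightarrow> A r c = A' r c * x c + A' r (Suc c)"
    and "\<And>r. r < n \<Longrightarrow> v r = A' r 0"
  shows "bordered n v A t = flag_minor A' t (n - t)"
  unfolding bordered_def flag_minor_def
  by (subst det_mat_bidiagonal_right[where d = "\<lambda>_. 1" and e = "\<lambda>c. x (c - 1)"
        and f = "\<lambda>r c. A' (t + r) c"]) (use assms in auto)

lemma peel_eq:
  assumes A: "\<And>r c. r < n \<Longrightarrow> c < n \<Longrightarrow> A r c = A' r c * x c + A' r (Suc c)"
    and A': "\<And>r c. r < c \<Longrightarrow> A' r c = 0" "\<And>c. c < n \<Longrightarrow> A' c c \<noteq> 0"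
    and v: "\<And>r. r < n \<Longrightarrow> v r = A' r 0"
    and "r < n" "c < n"
  shows "peel A v c r = A' r c"
  using assms(5,6)
proof (induction c arbitrary: r)
  case (Suc c)
  then have "peel A v (Suc c) r = A r c - A c c / A' c c * A' r c" by simp
  also have "A c c = A' c c * x c" using A[of c c] A'(1)[of c "Suc c"] Suc.prems by simp
  finally show ?case using A[of r c] A'(2)[of c] Suc.prems by simp
qed (use v in auto)

text \<open>The unit of column \<open>c\<close> of \<open>A\<close>, in row
  \<open>c + k + 1\<close>, becomes the band of width \<open>k\<close> in column
  \<open>c + 1\<close>. Column \<open>n\<close> lies wholly above the diagonal and vanishes, so the
  factorisation leaves no remainder at the right edge.\<close>

lemma peel_banded:
  assumes A: "banded n (Suc k) A" and v: "\<And>r. r < n \<Longrightarrow> k \<le> r \<Longrightarrow> v r = of_bool (r = k)"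
    and nz: "\<And>c. c < n \<Longrightarrow> peel A v c c \<noteq> 0"
  shows "banded n k (\<lambda>r c. peel A v c r)" and "r < n \<Longrightarrow> peel A v n r = 0"
proof -
  have col: "(r < c \<or> c + k < r \<longrightarrow> peel A v c r = 0) \<and> (r = c + k \<longrightarrow> peel A v c r = 1)"
    if "r < n" "c \<le> n" for r c
    using that
  proof (induction c arbitrary: r)
    case (Suc c)
    have "r < c \<or> c + Suc k < r \<longrightarrow> A r c = 0" "r = c + Suc k \<longrightarrow> A r c = 1"
      using A Suc.prems unfolding banded_def by auto
    then show ?case using Suc.IH[of r] Suc.prems nz[of c] by (auto simp: less_Suc_eq)
  qed (use v in auto)
  then show "banded n k (\<lambda>r c. peel A v c r)" unfolding banded_def by auto
  show "peel A v n r = 0" if "r < n" using col[of r n] that by auto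
qed

lemma shape_minor_ge: "min k n \<le> t \<Longrightarrow> shape_minor n Q k t = 1"
  by (simp add: shape_minor_def)

lemma shape_minor_nonzero: "Q \<in> GT_torus m n \<Longrightarrow> k \<le> m \<Longrightarrow> shape_minor n Q k t \<noteq> 0"
  by (auto simp: shape_minor_def GT_torus_def)

lemma shape_minor_gRSK_Q:
  assumes "nondegenerate m n x" "k \<le> m" "t \<le> min k n"
  shows "shape_minor n (gRSK_Q m n x) k t = flag_minor (wprod x k) t (n - t)"
proof -
  have "shape_minor n (gRSK_Q m n x) k t = (\<Prod>l\<in>{Suc t..min k n}.
      flag_minor (wprod x k) (l - 1) (n - (l - 1)) / flag_minor (wprod x k) l (n - l))"
    unfolding shape_minor_def by (intro prod.cong) (auto simp: gRSK_Q_flag_minor Suc_diff_le)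
  also have "\<dots> = flag_minor (wprod x k) t (n - t) / flag_minor (wprod x k) (min k n) (n - min k n)"
    using assms nondegenerateD[OF assms(1,2)]
    by (intro prod_telescope[where f = "\<lambda>l. flag_minor (wprod x k) l (n - l)"]) auto
  also have "flag_minor (wprod x k) (min k n) (n - min k n) = 1"
    using flag_minor_banded[OF banded_wprod, of k "n - k" n x] by (auto simp: min_def)
  finally show ?thesis by simp
qed

lemma wprod_diag_nonzero:
  assumes "x \<in> Mat_torus m n" "k \<le> m" "c < n"
  shows "wprod x k c c \<noteq> 0"
  using assms by (auto simp: wprod_diag Mat_torus_def)

lemma unwind_gRSK:
  assumes x: "nondegenerate m n x" "x \<in> Mat_torus m n" and "d \<le> m" "r < n" "c < n"
  shows "unwind m n (gRSK_P m n x) (gRSK_Q m n x) d r c = wprod x (m - d) r c"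
  using assms(3-)
proof (induction d arbitrary: r c)
  case 0
  then show ?case using gt_prod_gRSK_P[OF x(1)] by (simp add: gt_eq_def)
next
  case (Suc d)
  define A where "A = unwind m n (gRSK_P m n x) (gRSK_Q m n x) d"
  define k where "k = m - Suc d"
  have k: "m - d = Suc k" "k < m" using Suc.prems by (auto simp: k_def)
  have A: "A r c = wprod x k r c * x (Suc k) (Suc c) + wprod x k r (Suc c)" if "r < n" "c < n" for r c
    using Suc.IH[OF _ that] Suc.prems k by (simp add: A_def)
  have minor: "flag_minor A t s = flag_minor (wprod x (Suc k)) t s" if "t + s \<le> n" for t s
    using that A by (intro flag_minor_cong) auto
  let ?v = "first_column n k A (shape_minor n (gRSK_Q m n x) k) (min k n)"
  have v: "?v r = wprod x k r 0" if "r < n" for r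
  proof (rule first_column_unique[OF _ _ _ that])
    show "flag_minor A (Suc t) (n - Suc t) \<noteq> 0" if "t < min k n" for t
      using that k nondegenerateD[OF x(1), of "Suc k" "Suc t" "n - Suc t"] by (simp add: minor)
    show "bordered n (\<lambda>r. wprod x k r 0) A t = shape_minor n (gRSK_Q m n x) k t" if "t < min k n" for t
      using that k by (subst bordered_peel[where A' = "wprod x k" and x = "\<lambda>c. x (Suc k) (Suc c)"])
        (auto simp: A shape_minor_gRSK_Q[OF x(1)])
    show "wprod x k r 0 = of_bool (r = k)" if "min k n \<le> r" "r < n" for r
      using that wprod_band[of x k 0] by (auto simp: wprod_lower)
  qed
  have "unwind m n (gRSK_P m n x) (gRSK_Q m n x) (Suc d) r c = peel A ?v c r"
    by (simp add: A_def k_def Let_def)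
  also have "\<dots> = wprod x k r c"
    using Suc.prems k by (intro peel_eq[OF A _ _ v]) (auto simp: wprod_upper wprod_diag_nonzero[OF x(2)])
  finally show ?case by (simp add: k_def)
qed

lemma gRSK_inv_gRSK:
  assumes x: "nondegenerate m n x" "x \<in> Mat_torus m n"
  shows "mat_eq m n (gRSK_inv m n (gRSK m n x)) x"
proof -
  have "gRSK_inv m n (gRSK m n x) i j = x i j" if ij: "1 \<le> i" "i \<le> m" "1 \<le> j" "j \<le> n" for i j
  proof -
    have "m - (m - i) = i" "m - Suc (m - i) = i - 1" using ij by auto
    then have "gRSK_inv m n (gRSK m n x) i j = wprod x i (j - 1) (j - 1) / wprod x (i - 1) (j - 1) (j - 1)"
      unfolding gRSK_inv_def using ij by (simp add: gRSK_def unwind_gRSK[OF x] del: unwind.simps)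
    moreover obtain k where "i = Suc k" using ij by (cases i) auto
    ultimately show ?thesis using ij wprod_diag_nonzero[OF x(2), of k "j - 1"] by (simp add: wprod_upper)
  qed
  then show ?thesis by (simp add: mat_eq_def)
qed

text \<open>The prescribed minors are products of entries of \<open>Q\<close>, hence nonzero, and
  this makes the next triangular system solvable. The base case is where equality of the shapes of
  \<open>P\<close> and \<open>Q\<close> enters.\<close>

lemma unwind_banded:
  assumes PQ: "(P, Q) \<in> XGT m n"
    and nz: "\<And>d c. d \<le> m \<Longrightarrow> c < n \<Longrightarrow> unwind m n P Q d c c \<noteq> 0"
    and "d \<le> m"
  shows "banded n (m - d) (unwind m n P Q d) \<and>
    (\<forall>t\<le>min (m - d) n. flag_minor (unwind m n P Q d) t (n - t) = shape_minor n Q (m - d) t)"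
  using \<open>d \<le> m\<close>
proof (induction d)
  case 0
  have "banded n m (gt_prod P (min m n))"
    using banded_gt_prod[of n "min m n" P] by (cases "m \<le> n") (auto simp: banded_def)
  moreover have "flag_minor (gt_prod P (min m n)) t (n - t) = shape_minor n Q m t" if "t \<le> min m n" for t
    using that PQ unfolding shape_minor_def
    by (subst flag_minor_gt_prod) (auto simp: XGT_def GT_torus_def intro!: prod.cong)
  ultimately show ?case by simp
next
  case (Suc d)
  define A where "A = unwind m n P Q d"
  define k where "k = m - Suc d"
  have k: "m - d = Suc k" "k < m" using Suc.prems by (auto simp: k_def)
  have A: "banded n (Suc k) A"
    "\<And>t. t \<le> min (Suc k) n \<Longrightarrow> flag_minor A t (n - t) = shape_minor n Q (Suc k) t"
    using Suc k by (auto simp: A_def)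
  define v where "v = first_column n k A (shape_minor n Q k) (min k n)"
  have unwind: "unwind m n P Q (Suc d) = (\<lambda>r c. peel A v c r)"
    by (simp add: A_def k_def v_def Let_def)
  have v: "v r = of_bool (r = k)" if "r < n" "k \<le> r" for r
    using that unfolding v_def by (intro first_column_outside) auto
  have nz': "peel A v c c \<noteq> 0" if "c < n" for c
    using nz[of "Suc d" c] that Suc.prems unfolding unwind by auto
  note banded = peel_banded(1)[OF A(1) v nz']
  have "flag_minor (\<lambda>r c. peel A v c r) t (n - t) = shape_minor n Q k t" if t: "t \<le> min k n" for t
  proof (cases "t = min k n")
    case True
    then show ?thesis using flag_minor_banded[OF banded, of "n - k"]
      by (auto simp: shape_minor_ge min_def)
  next
    case False
    have "flag_minor (\<lambda>r c. peel A v c r) t (n - t) = bordered n v A t"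
      by (rule bordered_peel[symmetric, where x = "\<lambda>c. A c c / peel A v c c"]) auto
    also have "\<dots> = shape_minor n Q k t"
      unfolding v_def
    proof (rule bordered_first_column)
      show "flag_minor A (Suc t) (n - Suc t) \<noteq> 0" if "t < min k n" for t
        using that A(2)[of "Suc t"] PQ k shape_minor_nonzero[of Q m n "Suc k" "Suc t"] by (auto simp: XGT_def)
    qed (use t False in auto)
    finally show ?thesis .
  qed
  with banded show ?case unfolding unwind by (simp add: k_def)
qed

text \<open>After \<open>m\<close> peelings the band has width 0 and the matrix is the identity, so
  the factors removed multiply back to every intermediate matrix.\<close>

lemma wprod_gRSK_inv:
  assumes PQ: "(P, Q) \<in> XGT m n"
    and nz: "\<And>d c. d \<le> m \<Longrightarrow> c < n \<Longrightarrow> unwind m n P Q d c c \<noteq> 0"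
    and "k \<le> m" "r < n" "c < n"
  shows "wprod (gRSK_inv m n (P, Q)) k r c = unwind m n P Q (m - k) r c"
  using assms(3-)
proof (induction k arbitrary: r c)
  case 0
  then show ?case using unwind_banded[OF PQ nz, of m]
    by (cases r c rule: linorder_cases) (auto simp: banded_def)
next
  case (Suc k)
  define d where "d = m - Suc k"
  define A where "A = unwind m n P Q d"
  define v where "v = first_column n k A (shape_minor n Q k) (min k n)"
  have d: "m - k = Suc d" "d < m" "m - d = Suc k" using Suc.prems by (auto simp: d_def)
  then have "m - Suc d = k" by simp
  then have unwind: "unwind m n P Q (Suc d) = (\<lambda>r c. peel A v c r)"
    by (simp add: A_def v_def Let_def)
  have v: "v r = of_bool (r = k)" if "r < n" "k \<le> r" for r
    using that unfolding v_def by (intro first_column_outside) auto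
  have nz': "peel A v c c \<noteq> 0" if "c < n" for c
    using nz[of "Suc d" c] that d unfolding unwind by auto
  have "banded n (Suc k) A" using unwind_banded[OF PQ nz, of d] d by (simp add: A_def)
  note last = peel_banded(2)[OF this v nz']
  have IH: "wprod (gRSK_inv m n (P, Q)) k r c = peel A v c r" if "c < n" for c
    using Suc.IH[OF _ Suc.prems(2) that] Suc.prems d by (simp add: unwind del: unwind.simps)
  \<comment> \<open>In the last column the induction hypothesis no longer applies; there both sides
    are 0.\<close>
  have "wprod (gRSK_inv m n (P, Q)) k r (Suc c) = peel A v (Suc c) r"
  proof (cases "Suc c < n")
    case False
    then have "Suc c = n" using Suc.prems by simp
    then show ?thesis using last[of r] Suc.prems by (simp add: wprod_upper del: peel.simps)
  qed (rule IH)
  moreover have "gRSK_inv m n (P, Q) (Suc k) (Suc c) = A c c / peel A v c c"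
    by (simp add: gRSK_inv_def d_def[symmetric] unwind A_def[symmetric] del: unwind.simps)
  ultimately have "wprod (gRSK_inv m n (P, Q)) (Suc k) r c = A r c"
    using IH[of c] Suc.prems by simp
  then show ?case by (simp add: A_def d_def)
qed

lemma gRSK_gRSK_inv:
  assumes PQ: "(P, Q) \<in> XGT m n"
    and nz: "\<And>d c. d \<le> m \<Longrightarrow> c < n \<Longrightarrow> unwind m n P Q d c c \<noteq> 0"
  shows "gRSK_inv m n (P, Q) \<in> Mat_torus m n"
    and "gt_eq n m (gRSK_P m n (gRSK_inv m n (P, Q))) P"
    and "gt_eq m n (gRSK_Q m n (gRSK_inv m n (P, Q))) Q"
proof -
  let ?x = "gRSK_inv m n (P, Q)"
  show "?x \<in> Mat_torus m n"
    using nz by (auto simp: Mat_torus_def gRSK_inv_def simp del: unwind.simps)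
  have P: "P \<in> GT_torus n m" and Q: "Q \<in> GT_torus m n" using PQ by (auto simp: XGT_def)
  have minor: "flag_minor (wprod ?x k) t s = flag_minor (unwind m n P Q (m - k)) t s"
    if "k \<le> m" "t + s \<le> n" for k t s
    using that by (intro flag_minor_cong wprod_gRSK_inv[OF PQ nz]) auto
  have "gRSK_P m n ?x i j = P i j" if ij: "1 \<le> i" "i \<le> m" "i \<le> j" "j \<le> n" for i j
  proof -
    have gt: "flag_minor (gt_prod P (min m n)) t (j - t) = (\<Prod>l\<in>{Suc t..min (min m n) j}. P l j)"
      if "t \<le> i" for t
      using that P ij by (subst flag_minor_gt_prod) (auto simp: GT_torus_def)
    have "{Suc (i - 1)..min (min m n) j} = insert i {Suc i..min (min m n) j}" using ij by auto
    moreover have "(\<Prod>l\<in>{Suc i..min (min m n) j}. P l j) \<noteq> 0"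
      using P ij by (auto simp: GT_torus_def)
    moreover have "Suc j - i = j - (i - 1)" using ij by simp
    ultimately show ?thesis
      using ij gt[of i] gt[of "i - 1"] by (simp add: gRSK_P_flag_minor minor)
  qed
  then show "gt_eq n m (gRSK_P m n ?x) P" by (simp add: gt_eq_def)
  have "gRSK_Q m n ?x j i = Q j i" if ij: "1 \<le> j" "j \<le> n" "j \<le> i" "i \<le> m" for i j
  proof -
    have sh: "flag_minor (wprod ?x i) t (n - t) = shape_minor n Q i t" if "t \<le> min i n" for t
      using that ij unwind_banded[OF PQ nz, of "m - i"] by (subst minor) auto
    have "j - 1 \<le> min i n" "Suc n - j = n - (j - 1)" using ij by auto
    then have "flag_minor (wprod ?x i) (j - 1) (Suc n - j) = shape_minor n Q i (j - 1)"
      using sh by metis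
    then have "gRSK_Q m n ?x j i = shape_minor n Q i (j - 1) / shape_minor n Q i j"
      using ij sh[of j] by (simp add: gRSK_Q_flag_minor)
    moreover have "{Suc (j - 1)..min i n} = insert j {Suc j..min i n}" using ij by auto
    then have "shape_minor n Q i (j - 1) = Q j i * shape_minor n Q i j"
      by (simp add: shape_minor_def)
    ultimately show ?thesis using shape_minor_nonzero[OF Q, of i j] ij by simp
  qed
  then show "gt_eq m n (gRSK_Q m n ?x) Q" by (simp add: gt_eq_def)
qed

section \<open>Regularity of the inverse at a point of the image\<close>

lemma regular_at_flag_minor:
  assumes "\<And>r c. r < s \<Longrightarrow> c < s \<Longrightarrow> regular_at C y\<^sub>0 (\<lambda>y. A y (t + r) c)"
  shows "regular_at C y\<^sub>0 (\<lambda>y. flag_minor (A y) t s)"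
  unfolding flag_minor_def by (rule regular_at.det) (rule assms)

lemma regular_at_first_column:
  assumes A: "\<And>r c. r < n \<Longrightarrow> c < n \<Longrightarrow> regular_at C y\<^sub>0 (\<lambda>y. A y r c)"
    and \<tau>: "\<And>t. t < min k n \<Longrightarrow> regular_at C y\<^sub>0 (\<lambda>y. \<tau> y t)"
    and nz: "\<And>t. t < min k n \<Longrightarrow> flag_minor (A y\<^sub>0) (Suc t) (n - Suc t) \<noteq> 0"
    and "s \<le> min k n" "r < n"
  shows "regular_at C y\<^sub>0 (\<lambda>y. first_column n k (A y) (\<tau> y) s r)"
  using assms(4,5)
proof (induction s arbitrary: r)
  case 0
  then show ?case by (simp add: regular_at.const)
next
  case (Suc s)
  define t where "t = min k n - Suc s"
  have t: "t < min k n" using Suc.prems by (auto simp: t_def)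
  have "regular_at C y\<^sub>0 (\<lambda>y. bordered n (first_column n k (A y) (\<tau> y) s) (A y) t)"
    unfolding bordered_def
  proof (rule regular_at.det)
    fix i j assume "i < n - t" "j < n - t"
    then show "regular_at C y\<^sub>0 (\<lambda>y. if j = 0 then first_column n k (A y) (\<tau> y) s (t + i) else A y (t + i) (j - 1))"
      using Suc A by (cases "j = 0") auto
  qed
  then have "regular_at C y\<^sub>0 (\<lambda>y. (\<tau> y t - bordered n (first_column n k (A y) (\<tau> y) s) (A y) t)
      / flag_minor (A y) (Suc t) (n - Suc t))"
    using nz t by (intro regular_at_divide regular_at.diff \<tau> regular_at_flag_minor A) auto
  then show ?case using Suc by (cases "r = t") (auto simp: Let_def t_def[symmetric])
qed

lemma regular_at_peel:
  assumes A: "\<And>r c. r < n \<Longrightarrow> c < n \<Longrightarrow> regular_at C y\<^sub>0 (\<lambda>y. A y r c)"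
    and v: "\<And>r. r < n \<Longrightarrow> regular_at C y\<^sub>0 (\<lambda>y. v y r)"
    and nz: "\<And>c. c < n \<Longrightarrow> peel (A y\<^sub>0) (v y\<^sub>0) c c \<noteq> 0"
    and "r < n" "c < n"
  shows "regular_at C y\<^sub>0 (\<lambda>y. peel (A y) (v y) c r)"
  using assms(4,5)
proof (induction c arbitrary: r)
  case 0
  then show ?case by (simp add: v)
next
  case (Suc c)
  then show ?case unfolding peel.simps
    by (intro regular_at.diff regular_at.mult regular_at_divide A nz) auto
qed

lemma regular_at_gt_prod:
  assumes "\<And>i j. 1 \<le> i \<Longrightarrow> i \<le> k \<Longrightarrow> i \<le> j \<Longrightarrow> j \<le> n \<Longrightarrow> fst y\<^sub>0 i j \<noteq> 0" "r < n"
  shows "regular_at pair_coords y\<^sub>0 (\<lambda>y. gt_prod (fst y) k r c)"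
  using assms
proof (induction k arbitrary: r)
  case 0
  then show ?case by (simp add: regular_at.const)
next
  case (Suc k)
  have P: "regular_at pair_coords y\<^sub>0 (\<lambda>y. fst y i j)" for i j
    by (intro regular_at_poly poly_coord) (auto simp: pair_coords_def)
  have IH: "regular_at pair_coords y\<^sub>0 (\<lambda>y. gt_prod (fst y) k r c)" if "r < n" for r
    using Suc that by simp
  consider "r < k" | "r = k" | "k < r" by linarith
  then show ?case
  proof cases
    case 1
    then show ?thesis using IH Suc.prems by simp
  next
    case 2
    then show ?thesis using regular_at.mult[OF P IH] Suc.prems by simp
  next
    case 3
    with Suc.prems have "regular_at pair_coords y\<^sub>0 (\<lambda>y. fst y (Suc k) (Suc r) / fst y (Suc k) r
        * gt_prod (fst y) k r c + gt_prod (fst y) k (r - 1) c)"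
      by (intro regular_at.add regular_at.mult regular_at_divide P IH) auto
    with 3 show ?thesis by simp
  qed
qed

text \<open>At \<open>gRSK m n x\<close> the recursion runs through the partial products of
  \<open>x\<close>, so each denominator is a nonzero minor or diagonal entry of one of them, or a
  nonzero entry of \<open>P\<close>.\<close>

lemma regular_at_unwind:
  assumes x: "nondegenerate m n x" "x \<in> Mat_torus m n" and "d \<le> m" "r < n" "c < n"
  shows "regular_at pair_coords (gRSK m n x) (\<lambda>y. unwind m n (fst y) (snd y) d r c)"
  using assms(3-)
proof (induction d arbitrary: r c)
  case 0
  have "gRSK_P m n x \<in> GT_torus n m" using gRSK_in_XGT[OF x(1)] by (simp add: gRSK_def XGT_def)
  with 0 show ?case unfolding unwind.simps
    by (intro regular_at_gt_prod[where n = n]) (auto simp: gRSK_def GT_torus_def)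
next
  case (Suc d)
  let ?y0 = "gRSK m n x"
  define A where "A = (\<lambda>y. unwind m n (fst y) (snd y) d)"
  define k where "k = m - Suc d"
  have k: "m - d = Suc k" "k < m" using Suc.prems by (auto simp: k_def)
  define v where "v = (\<lambda>y. first_column n k (A y) (shape_minor n (snd y) k) (min k n))"
  have unwind: "unwind m n (fst y) (snd y) (Suc d) = (\<lambda>r c. peel (A y) (v y) c r)" for y
    by (simp add: A_def k_def v_def Let_def)
  have A: "regular_at pair_coords ?y0 (\<lambda>y. A y r c)" if "r < n" "c < n" for r c
    using Suc that by (simp add: A_def)
  have "A ?y0 r c = wprod x (Suc k) r c" if "r < n" "c < n" for r c
    using unwind_gRSK[OF x, of d r c] that Suc.prems k by (simp add: A_def gRSK_def)
  then have minor: "flag_minor (A ?y0) t s = flag_minor (wprod x (Suc k)) t s" if "t + s \<le> n" for t s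
    using that by (intro flag_minor_cong) auto
  have Q: "regular_at pair_coords ?y0 (\<lambda>y. shape_minor n (snd y) k t)" for t
    unfolding shape_minor_def
    by (intro regular_at.prod regular_at_poly poly_coord) (auto simp: pair_coords_def)
  have v: "regular_at pair_coords ?y0 (\<lambda>y. v y r)" if "r < n" for r
    unfolding v_def
  proof (rule regular_at_first_column[OF A Q _ order_refl that])
    fix t assume "t < min k n"
    then show "flag_minor (A ?y0) (Suc t) (n - Suc t) \<noteq> 0"
      using k nondegenerateD[OF x(1), of "Suc k" "Suc t" "n - Suc t"] by (simp add: minor)
  qed
  have "peel (A ?y0) (v ?y0) c c \<noteq> 0" if "c < n" for c
  proof -
    have "peel (A ?y0) (v ?y0) c c = unwind m n (fst ?y0) (snd ?y0) (Suc d) c c"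
      by (simp only: unwind)
    then show ?thesis
      using unwind_gRSK[OF x Suc.prems(1) that that] wprod_diag_nonzero[OF x(2), of "m - Suc d" c] that
      by (simp add: gRSK_def del: unwind.simps)
  qed
  from regular_at_peel[OF A v this Suc.prems(2,3)] show ?case unfolding unwind .
qed

lemma unwind_gRSK_diag_nonzero:
  assumes "nondegenerate m n x" "x \<in> Mat_torus m n" "d \<le> m" "c < n"
  shows "unwind m n (fst (gRSK m n x)) (snd (gRSK m n x)) d c c \<noteq> 0"
  using assms unwind_gRSK[OF assms assms(4)] by (simp add: gRSK_def wprod_diag_nonzero)

lemma rat_in_gRSK_inv:
  assumes "1 \<le> i" "i \<le> m" "1 \<le> j" "j \<le> n"
  shows "rat_in pair_coords (\<lambda>y. gRSK_inv m n y i j)"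
proof -
  obtain x where x: "x \<in> Mat_torus m n" "nondegenerate m n x"
    using generic_onE[OF generic_nondegenerate] .
  show ?thesis unfolding gRSK_inv_def using assms
    by (intro rat_in_divide regular_at_imp_rat_in[OF regular_at_unwind[OF x(2,1)]]) auto
qed

lemma generic_gRSK_gRSK_inv:
  "generic_on pair_coords (XGT m n) (\<lambda>y. gRSK_inv m n y \<in> Mat_torus m n \<and>
     gt_eq n m (gRSK_P m n (gRSK_inv m n y)) (fst y) \<and> gt_eq m n (gRSK_Q m n (gRSK_inv m n y)) (snd y))"
proof -
  obtain x where x: "x \<in> Mat_torus m n" "nondegenerate m n x"
    using generic_onE[OF generic_nondegenerate] .
  have "generic_on pair_coords (XGT m n)
      (\<lambda>y. \<forall>i\<in>{..m} \<times> {..<n}. unwind m n (fst y) (snd y) (fst i) (snd i) (snd i) \<noteq> 0)"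
    using regular_at_unwind[OF x(2,1)] unwind_gRSK_diag_nonzero[OF x(2,1)]
    by (intro generic_on_regular_nonzero[where y\<^sub>0 = "gRSK m n x"] gRSK_in_XGT x) auto
  then show ?thesis
  proof (rule generic_on_mono)
    fix y assume y: "y \<in> XGT m n"
      "\<forall>i\<in>{..m} \<times> {..<n}. unwind m n (fst y) (snd y) (fst i) (snd i) (snd i) \<noteq> 0"
    then have "unwind m n (fst y) (snd y) d c c \<noteq> 0" if "d \<le> m" "c < n" for d c
      using that by auto
    from gRSK_gRSK_inv[of "fst y" "snd y", unfolded prod.collapse, OF y(1) this]
    show "gRSK_inv m n y \<in> Mat_torus m n \<and>
     gt_eq n m (gRSK_P m n (gRSK_inv m n y)) (fst y) \<and> gt_eq m n (gRSK_Q m n (gRSK_inv m n y)) (snd y)"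
      by simp
  qed
qed

theorem theorem4p10:
  fixes m n :: nat
  assumes "1 \<le> m" and "1 \<le> n"
  shows
    \<comment> \<open>gRSK is a birational isomorphism Mat_{m x n}(C^*) --> X^GT\<close>
    "(\<forall>i j. 1 \<le> i \<and> i \<le> m \<and> i \<le> j \<and> j \<le> n \<longrightarrow> rat_in mat_coords (\<lambda>x. gRSK_P m n x i j))
   \<and> (\<forall>j' i'. 1 \<le> j' \<and> j' \<le> n \<and> j' \<le> i' \<and> i' \<le> m \<longrightarrow> rat_in mat_coords (\<lambda>x. gRSK_Q m n x j' i'))
   \<and> generic_on mat_coords (Mat_torus m n) (\<lambda>x. gRSK m n x \<in> XGT m n)
   \<and> (\<exists>g. (\<forall>i j. 1 \<le> i \<and> i \<le> m \<and> 1 \<le> j \<and> j \<le> n \<longrightarrow> rat_in pair_coords (\<lambda>y. g y i j))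
         \<and> generic_on mat_coords (Mat_torus m n) (\<lambda>x. mat_eq m n (g (gRSK m n x)) x)
         \<and> generic_on pair_coords (XGT m n)
             (\<lambda>y. g y \<in> Mat_torus m n \<and> gt_eq n m (gRSK_P m n (g y)) (fst y)
                                       \<and> gt_eq m n (gRSK_Q m n (g y)) (snd y)))
   \<and> generic_on mat_coords (Mat_torus m n)
       (\<lambda>x. (\<forall>k. 1 \<le> k \<and> k \<le> n \<longrightarrow> col_pi m x k = gt_gamma n m (gRSK_P m n x) k)
          \<and> (\<forall>k. 1 \<le> k \<and> k \<le> m \<longrightarrow> row_pi n x k = gt_gamma m n (gRSK_Q m n x) k))
   \<and> (\<forall>j. 1 \<le> j \<and> j \<le> n - 1 \<longrightarrow> generic_on mat_coords (Mat_torus m n)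
       (\<lambda>x. col_eps m x j = gt_eps n m (gRSK_P m n x) j
          \<and> col_phi m x j = gt_phi n m (gRSK_P m n x) j))
   \<and> (\<forall>i. 1 \<le> i \<and> i \<le> m - 1 \<longrightarrow> generic_on mat_coords (Mat_torus m n)
       (\<lambda>x. row_eps n x i = gt_eps m n (gRSK_Q m n x) i
          \<and> row_phi n x i = gt_phi m n (gRSK_Q m n x) i))
   \<and> (\<forall>j c. 1 \<le> j \<and> j \<le> n - 1 \<and> c \<noteq> 0 \<longrightarrow> generic_on mat_coords (Mat_torus m n)
       (\<lambda>x. gt_eq n m (gRSK_P m n (col_e m j c x)) (gt_e n m j c (gRSK_P m n x))
          \<and> gt_eq m n (gRSK_Q m n (col_e m j c x)) (gRSK_Q m n x)))
   \<and> (\<forall>i c. 1 \<le> i \<and> i \<le> m - 1 \<and> c \<noteq> 0 \<longrightarrow> generic_on mat_coords (Mat_torus m n)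
       (\<lambda>x. gt_eq n m (gRSK_P m n (row_e n i c x)) (gRSK_P m n x)
          \<and> gt_eq m n (gRSK_Q m n (row_e n i c x)) (gt_e m n i c (gRSK_Q m n x))))"
proof (intro conjI)
  show "\<forall>i j. 1 \<le> i \<and> i \<le> m \<and> i \<le> j \<and> j \<le> n \<longrightarrow> rat_in mat_coords (\<lambda>x. gRSK_P m n x i j)"
    "\<forall>j' i'. 1 \<le> j' \<and> j' \<le> n \<and> j' \<le> i' \<and> i' \<le> m \<longrightarrow> rat_in mat_coords (\<lambda>x. gRSK_Q m n x j' i')"
    by (auto intro: rat_in_gRSK)
  show "generic_on mat_coords (Mat_torus m n) (\<lambda>x. gRSK m n x \<in> XGT m n)"
    by (rule generic_on_mono[OF generic_nondegenerate]) (rule gRSK_in_XGT)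
  show "\<exists>g. (\<forall>i j. 1 \<le> i \<and> i \<le> m \<and> 1 \<le> j \<and> j \<le> n \<longrightarrow> rat_in pair_coords (\<lambda>y. g y i j))
         \<and> generic_on mat_coords (Mat_torus m n) (\<lambda>x. mat_eq m n (g (gRSK m n x)) x)
         \<and> generic_on pair_coords (XGT m n)
             (\<lambda>y. g y \<in> Mat_torus m n \<and> gt_eq n m (gRSK_P m n (g y)) (fst y)
                                       \<and> gt_eq m n (gRSK_Q m n (g y)) (snd y))"
    using rat_in_gRSK_inv generic_gRSK_gRSK_inv generic_on_mono[OF generic_nondegenerate gRSK_inv_gRSK]
    by (intro exI[of _ "gRSK_inv m n"]) auto
  show "generic_on mat_coords (Mat_torus m n)
       (\<lambda>x. (\<forall>k. 1 \<le> k \<and> k \<le> n \<longrightarrow> col_pi m x k = gt_gamma n m (gRSK_P m n x) k)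
          \<and> (\<forall>k. 1 \<le> k \<and> k \<le> m \<longrightarrow> row_pi n x k = gt_gamma m n (gRSK_Q m n x) k))"
    \<comment> \<open>Columns are treated directly, rows through the transposed array with
      \<open>Q\<close> in the role of \<open>z\<close>.\<close>
    by (rule generic_on_mono[OF generic_on_Mat_conj[OF generic_gamma[of m n]
          generic_on_transp[OF generic_gamma[of n m]]]])
      (use gt_eq_gRSK_Q[of m n] in \<open>auto simp: row_transp gt_eq_def[of _ _ "gRSK_P m n _"]\<close>)
  show "\<forall>j. 1 \<le> j \<and> j \<le> n - 1 \<longrightarrow> generic_on mat_coords (Mat_torus m n)
       (\<lambda>x. col_eps m x j = gt_eps n m (gRSK_P m n x) j
          \<and> col_phi m x j = gt_phi n m (gRSK_P m n x) j)"
  proof (intro allI impI)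
    fix j assume "1 \<le> j \<and> j \<le> n - 1"
    then have "1 \<le> j" "j < n" by auto
    from generic_eps_phi[OF this, of m]
    show "generic_on mat_coords (Mat_torus m n)
       (\<lambda>x. col_eps m x j = gt_eps n m (gRSK_P m n x) j \<and> col_phi m x j = gt_phi n m (gRSK_P m n x) j)"
      by (rule generic_on_mono) (simp add: gt_eq_def)
  qed
  show "\<forall>i. 1 \<le> i \<and> i \<le> m - 1 \<longrightarrow> generic_on mat_coords (Mat_torus m n)
       (\<lambda>x. row_eps n x i = gt_eps m n (gRSK_Q m n x) i
          \<and> row_phi n x i = gt_phi m n (gRSK_Q m n x) i)"
  proof (intro allI impI)
    fix i assume "1 \<le> i \<and> i \<le> m - 1"
    then have "1 \<le> i" "i < m" by auto
    from generic_on_transp[OF generic_eps_phi[OF this, of n]]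
    show "generic_on mat_coords (Mat_torus m n)
       (\<lambda>x. row_eps n x i = gt_eps m n (gRSK_Q m n x) i \<and> row_phi n x i = gt_phi m n (gRSK_Q m n x) i)"
      by (rule generic_on_mono) (simp add: gt_eq_gRSK_Q row_transp)
  qed
  show "\<forall>j c. 1 \<le> j \<and> j \<le> n - 1 \<and> c \<noteq> 0 \<longrightarrow> generic_on mat_coords (Mat_torus m n)
       (\<lambda>x. gt_eq n m (gRSK_P m n (col_e m j c x)) (gt_e n m j c (gRSK_P m n x))
          \<and> gt_eq m n (gRSK_Q m n (col_e m j c x)) (gRSK_Q m n x))"
  proof (intro allI impI)
    fix j c assume "1 \<le> j \<and> j \<le> n - 1 \<and> (c :: complex) \<noteq> 0"
    then have "1 \<le> j" "j < n" "c \<noteq> 0" by auto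
    from generic_col_e[OF assms(1) this]
    show "generic_on mat_coords (Mat_torus m n)
       (\<lambda>x. gt_eq n m (gRSK_P m n (col_e m j c x)) (gt_e n m j c (gRSK_P m n x))
          \<and> gt_eq m n (gRSK_Q m n (col_e m j c x)) (gRSK_Q m n x))"
      by (rule generic_on_mono) (metis gt_eq_def)
  qed
  show "\<forall>i c. 1 \<le> i \<and> i \<le> m - 1 \<and> c \<noteq> 0 \<longrightarrow> generic_on mat_coords (Mat_torus m n)
       (\<lambda>x. gt_eq n m (gRSK_P m n (row_e n i c x)) (gRSK_P m n x)
          \<and> gt_eq m n (gRSK_Q m n (row_e n i c x)) (gt_e m n i c (gRSK_Q m n x)))"
  proof (intro allI impI)
    fix i c assume "1 \<le> i \<and> i \<le> m - 1 \<and> (c :: complex) \<noteq> 0"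
    then have "1 \<le> i" "i < m" "c \<noteq> 0" by auto
    then show "generic_on mat_coords (Mat_torus m n)
       (\<lambda>x. gt_eq n m (gRSK_P m n (row_e n i c x)) (gRSK_P m n x)
          \<and> gt_eq m n (gRSK_Q m n (row_e n i c x)) (gt_e m n i c (gRSK_Q m n x)))"
      by (rule generic_row_e[OF assms(2)])
  qed
qed

end
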